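(* Let $V$ be an irreducible variety defined over $\mathbb{Q}$, given as the common zero set of polynomials $F_1,\dots,F_n\in\mathbb{Z}[x_1,\dots,x_m]$. Then $$\chi\big(\mathrm{Cay}(\mathbb{C}^m,\pm V(\mathbb{C}))\big)=\sup_{p}\chi\big(\mathrm{Cay}(\mathbb{Z}_p^m,\pm V(\mathbb{Z}_p))\big),$$ provided one of the two sides is finite, where the supremum is over all primes $p$.
   Context: For a ring $R$ of characteristic zero, $V(R)=\{x\in R^m:F_i(x)=0,\ 1\le i\le n\}$; $\mathbb{Z}_p$ is the ring of $p$-adic integers. For an abelian group $\Gamma$ and $S\subseteq\Gamma$, $\mathrm{Cay}(\Gamma,\pm S)$ is the graph with vertex set $\Gamma$ in which distinct $x,y$ are adjacent iff $x-y\in S\cup(-S)$. $\chi$ denotes the (ordinary) chromatic number: the least cardinal $c$ such that the vertices can be partitioned into $c$ sets none of which contains two adjacent vertices. *)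

theory Defs
  imports
    "HOL-Algebra.Algebraic_Closure_Type"
    "HOL-Algebra.Product_Groups"
    "HOL-Library.Disjoint_Sets"
    "HOL-Library.Poly_Mapping"
    "HOL-Number_Theory.Residues"
    Complex_Main
begin

unbundle cardinal_syntax

section \<open>Cardinals\<close>

text \<open>
  Cardinals are represented as in the library, by cardinal orders \<open>r :: 'a rel\<close>, and compared
  by \<open>=o\<close> and \<open>\<le>o\<close>, which work across different types.
  The choice below picks one set of least cardinality among those satisfying \<open>Q\<close>.
\<close>

definition least_card :: "('a set \<Rightarrow> bool) \<Rightarrow> 'a rel" where
  "least_card Q = |SOME A. Q A \<and> (\<forall>B. Q B \<longrightarrow> |A| \<le>o |B| )|"

lemma least_card_ex:
  assumes "Q A0"
  shows "\<exists>A. Q A \<and> (\<forall>B. Q B \<longrightarrow> |A| \<le>o |B| )"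
proof -
  have "\<exists>r\<in>card_of ` Collect Q. \<forall>r'\<in>card_of ` Collect Q. r \<le>o r'"
    using assms by (intro exists_minim_Card_order) (auto simp: card_of_Card_order)
  then show ?thesis by blast
qed

lemma least_card_attained:
  assumes "Q A0"
  obtains A where "Q A" "least_card Q = |A|"
  using someI_ex[OF least_card_ex[of Q, OF assms]] that unfolding least_card_def by blast

lemma least_card_le:
  assumes "Q B"
  shows "least_card Q \<le>o |B|"
  using someI_ex[OF least_card_ex[of Q, OF assms]] assms unfolding least_card_def by blast

definition card_sup :: "'a rel set \<Rightarrow> 'a rel" where
  "card_sup K = least_card (\<lambda>A. \<forall>r\<in>K. r \<le>o |A| )"

lemma card_sup_Card_order: "Card_order (card_sup K)"
  unfolding card_sup_def least_card_def by (rule card_of_Card_order)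

lemma card_sup_UNIV_bound:
  assumes "\<forall>r\<in>K. Card_order (r :: 'a rel)"
  shows "\<forall>r\<in>K. r \<le>o |UNIV :: 'a set|"
proof
  fix r assume "r \<in> K"
  then have "r =o |Field r|"
    using assms card_of_Field_ordIso ordIso_symmetric by blast
  moreover have "|Field r| \<le>o |UNIV :: 'a set|" by (intro card_of_mono1) simp
  ultimately show "r \<le>o |UNIV :: 'a set|" by (rule ordIso_ordLeq_trans)
qed

lemma card_sup_upper:
  assumes "\<forall>r\<in>K. Card_order r" and "r \<in> K"
  shows "r \<le>o card_sup K"
proof -
  obtain A where "\<forall>r\<in>K. r \<le>o |A|" "card_sup K = |A|"
    unfolding card_sup_def
    by (rule least_card_attained[of "\<lambda>A. \<forall>r\<in>K. r \<le>o |A|", OF card_sup_UNIV_bound[OF assms(1)]])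
  then show ?thesis using assms(2) by simp
qed

text \<open>\<open>card_sup K\<close> lies below upper bounds over every type, not only below those over \<open>'a\<close>.\<close>

lemma card_sup_least:
  fixes K :: "'a rel set" and t :: "'b rel"
  assumes "\<forall>r\<in>K. Card_order r" and "Card_order t" and "\<forall>r\<in>K. r \<le>o t"
  shows "card_sup K \<le>o t"
proof -
  have t: "t =o |Field t|"
    by (rule ordIso_symmetric[OF card_of_Field_ordIso[OF assms(2)]])
  have ft: "|Field t| \<le>o t"
    by (rule ordIso_imp_ordLeq[OF card_of_Field_ordIso[OF assms(2)]])
  show ?thesis
  proof (cases "|UNIV :: 'a set| \<le>o |Field t|")
    case True
    have "card_sup K \<le>o |UNIV :: 'a set|"
      unfolding card_sup_def by (rule least_card_le) (rule card_sup_UNIV_bound[OF assms(1)])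
    also note True
    also have "|Field t| \<le>o t" by (rule ft)
    finally show ?thesis .
  next
    case False
    then have "|Field t| \<le>o |UNIV :: 'a set|"
      using ordLeq_total[OF card_of_Well_order[of "Field t"] card_of_Well_order[of "UNIV :: 'a set"]]
      by argo
    then obtain A :: "'a set" where A: "|Field t| =o |A|"
      by (drule_tac internalize_card_of_ordLeq2[THEN iffD1]) (elim exE conjE)
    have "card_sup K \<le>o |A|"
      unfolding card_sup_def
    proof (rule least_card_le, rule ballI)
      fix r assume "r \<in> K"
      then have "r \<le>o t" using assms(3) by auto
      also note t
      also note A
      finally show "r \<le>o |A|" .
    qed
    also have "|A| \<le>o |Field t|" by (rule ordIso_imp_ordLeq[OF ordIso_symmetric[OF A]])
    also have "|Field t| \<le>o t" by (rule ft)
    finally show ?thesis .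
  qed
qed


abbreviation finite_card :: "'a rel \<Rightarrow> bool" where
  "finite_card \<equiv> BNF_Cardinal_Arithmetic.cfinite"


section \<open>Chromatic numbers of Cayley graphs\<close>

text \<open>A graph is a vertex set together with its (symmetric, irreflexive) adjacency relation.\<close>

type_synonym 'v graph = "'v set \<times> 'v rel"

definition colour_classes :: "'v graph \<Rightarrow> 'v set set \<Rightarrow> bool" where
  "colour_classes G P \<longleftrightarrow>
     partition_on (fst G) P \<and> (\<forall>C\<in>P. \<forall>x\<in>C. \<forall>y\<in>C. (x, y) \<notin> snd G)"

definition chromatic_number :: "'v graph \<Rightarrow> 'v set rel" where
  "chromatic_number G = least_card (colour_classes G)"

text \<open>
  The abelian group is written multiplicatively here, so \<open>x \<otimes> inv y\<close> is the difference
  \<open>x - y\<close>.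
\<close>

definition Cay :: "('g, 'b) monoid_scheme \<Rightarrow> 'g set \<Rightarrow> 'g graph" where
  "Cay \<Gamma> S = (carrier \<Gamma>,
     {(x, y). x \<in> carrier \<Gamma> \<and> y \<in> carrier \<Gamma> \<and> x \<noteq> y \<and>
        x \<otimes>\<^bsub>\<Gamma>\<^esub> inv\<^bsub>\<Gamma>\<^esub> y \<in> S \<union> m_inv \<Gamma> ` S})"

lemma colour_classes_singletons:
  assumes "irrefl (snd G)"
  shows "colour_classes G ((\<lambda>x. {x}) ` fst G)"
  using assms by (auto simp: colour_classes_def irrefl_def partition_on_singletons)

lemma irrefl_Cay: "irrefl (snd (Cay \<Gamma> S))"
  by (auto simp: Cay_def irrefl_def)

lemma sym_Cay:
  assumes "group \<Gamma>" and "S \<subseteq> carrier \<Gamma>"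
  shows "sym (snd (Cay \<Gamma> S))"
proof (rule symI)
  interpret group \<Gamma> by fact
  fix x y assume xy: "(x, y) \<in> snd (Cay \<Gamma> S)"
  then have c: "x \<in> carrier \<Gamma>" "y \<in> carrier \<Gamma>" and "x \<noteq> y"
    and d: "x \<otimes>\<^bsub>\<Gamma>\<^esub> inv\<^bsub>\<Gamma>\<^esub> y \<in> S \<union> m_inv \<Gamma> ` S"
    by (auto simp: Cay_def)
  have e: "y \<otimes>\<^bsub>\<Gamma>\<^esub> inv\<^bsub>\<Gamma>\<^esub> x = inv\<^bsub>\<Gamma>\<^esub> (x \<otimes>\<^bsub>\<Gamma>\<^esub> inv\<^bsub>\<Gamma>\<^esub> y)"
    using c by (simp add: inv_mult_group)
  have "y \<otimes>\<^bsub>\<Gamma>\<^esub> inv\<^bsub>\<Gamma>\<^esub> x \<in> S \<union> m_inv \<Gamma> ` S"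
    using d assms(2) unfolding e by auto
  then show "(y, x) \<in> snd (Cay \<Gamma> S)"
    using c \<open>x \<noteq> y\<close> by (auto simp: Cay_def)
qed

lemma chromatic_number_le:
  "colour_classes G P \<Longrightarrow> chromatic_number G \<le>o |P|"
  unfolding chromatic_number_def by (rule least_card_le)

lemma chromatic_number_attained:
  assumes "irrefl (snd G)"
  obtains P where "colour_classes G P" "chromatic_number G = |P|"
  unfolding chromatic_number_def
  by (rule least_card_attained[of "colour_classes G", OF colour_classes_singletons[OF assms]])

lemma chromatic_number_Card_order: "Card_order (chromatic_number G)"
  unfolding chromatic_number_def least_card_def by (rule card_of_Card_order)


section \<open>The rings of complex numbers and of p-adic integers\<close>

abbreviation complex_ring :: "complex ring" where
  "complex_ring \<equiv> ring_of_type_algebra"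

text \<open>
  The inverse limit of the rings of integers modulo \<open>p ^ n\<close>, \<open>n \<ge> 1\<close>; entry \<open>n\<close> of a sequence is
  the canonical representative modulo \<open>p ^ (n + 1)\<close>. The trivial modulus \<open>p ^ 0\<close> is left out since
  the constant 1 of \<open>residue_ring 1\<close> is not in its carrier.
\<close>

definition padic_integers :: "nat \<Rightarrow> (nat \<Rightarrow> int) ring" where
  "padic_integers p =
     \<lparr>carrier = {x. \<forall>n. x n \<in> carrier (residue_ring (int p ^ Suc n)) \<and>
                          x (Suc n) mod int p ^ Suc n = x n},
      monoid.mult = (\<lambda>x y n. x n \<otimes>\<^bsub>residue_ring (int p ^ Suc n)\<^esub> y n),
      one = (\<lambda>n. \<one>\<^bsub>residue_ring (int p ^ Suc n)\<^esub>),
      zero = (\<lambda>n. \<zero>\<^bsub>residue_ring (int p ^ Suc n)\<^esub>),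
      add = (\<lambda>x y n. x n \<oplus>\<^bsub>residue_ring (int p ^ Suc n)\<^esub> y n)\<rparr>"

lemma padic_integers_simps:
  "x \<in> carrier (padic_integers p) \<longleftrightarrow>
     (\<forall>n. 0 \<le> x n \<and> x n < int p ^ Suc n \<and> x (Suc n) mod int p ^ Suc n = x n)"
  "x \<otimes>\<^bsub>padic_integers p\<^esub> y = (\<lambda>n. x n * y n mod int p ^ Suc n)"
  "\<one>\<^bsub>padic_integers p\<^esub> = (\<lambda>n. 1)"
  "\<zero>\<^bsub>padic_integers p\<^esub> = (\<lambda>n. 0)"
  "x \<oplus>\<^bsub>padic_integers p\<^esub> y = (\<lambda>n. (x n + y n) mod int p ^ Suc n)"
  by (auto simp: padic_integers_def residue_ring_def simp del: power_Suc)

lemma cring_padic_integers: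
  assumes "prime p"
  shows "cring (padic_integers p)"
proof -
  have p1: "1 < int p" using assms prime_gt_1_nat by auto
  have pos: "0 < int p ^ Suc n" for n using p1 by simp
  have gt: "1 < int p ^ Suc n" for n using p1 by (rule one_less_power) simp
  have dv: "int p ^ Suc n dvd int p ^ Suc (Suc n)" for n by (simp add: le_imp_power_dvd)
  note s = padic_integers_simps
  have modmod: "a mod int p ^ Suc (Suc n) mod int p ^ Suc n = a mod int p ^ Suc n" for a n
    using dv by (rule mod_mod_cancel)
  have closed: "(\<lambda>n. f n mod int p ^ Suc n) \<in> carrier (padic_integers p)"
    if "\<And>n. f (Suc n) mod int p ^ Suc n = f n mod int p ^ Suc n" for f
    unfolding s(1) using that pos by (auto simp only: modmod pos_mod_sign pos_mod_bound)
  have compat: "x (Suc n) mod int p ^ Suc n = x n" if "x \<in> carrier (padic_integers p)" for x n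
    using that unfolding s(1) by blast
  have id: "x n mod int p ^ Suc n = x n" if "x \<in> carrier (padic_integers p)" for x n
    using that unfolding s(1) by (simp del: power_Suc)
  have addc: "(\<lambda>n. (x n + y n) mod int p ^ Suc n) \<in> carrier (padic_integers p)"
    if "x \<in> carrier (padic_integers p)" "y \<in> carrier (padic_integers p)" for x y
    by (rule closed) (rule mod_add_cong; simp only: compat id that)
  have mulc: "(\<lambda>n. (x n * y n) mod int p ^ Suc n) \<in> carrier (padic_integers p)"
    if "x \<in> carrier (padic_integers p)" "y \<in> carrier (padic_integers p)" for x y
    by (rule closed) (rule mod_mult_cong; simp only: compat id that)
  have neg: "(\<lambda>n. (- x n) mod int p ^ Suc n) \<in> carrier (padic_integers p)"
    if "x \<in> carrier (padic_integers p)" for x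
    by (rule closed) (rule mod_minus_cong; simp only: compat id that)
  show ?thesis
  proof (intro cringI abelian_groupI comm_monoidI)
    fix x assume x: "x \<in> carrier (padic_integers p)"
    show "\<exists>y\<in>carrier (padic_integers p). y \<oplus>\<^bsub>padic_integers p\<^esub> x = \<zero>\<^bsub>padic_integers p\<^esub>"
    proof (rule bexI[OF _ neg[OF x]])
      show "(\<lambda>n. - x n mod int p ^ Suc n) \<oplus>\<^bsub>padic_integers p\<^esub> x = \<zero>\<^bsub>padic_integers p\<^esub>"
        unfolding s by (rule ext) (simp add: mod_add_left_eq del: power_Suc)
    qed
  next
    show "\<zero>\<^bsub>padic_integers p\<^esub> \<in> carrier (padic_integers p)"
      unfolding s using pos by (simp del: power_Suc)
    show "\<one>\<^bsub>padic_integers p\<^esub> \<in> carrier (padic_integers p)"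
      unfolding s using gt by (simp del: power_Suc)
  next
    fix x y assume xy: "x \<in> carrier (padic_integers p)" "y \<in> carrier (padic_integers p)"
    show "x \<oplus>\<^bsub>padic_integers p\<^esub> y \<in> carrier (padic_integers p)"
      unfolding s(5) using xy by (rule addc)
    show "x \<otimes>\<^bsub>padic_integers p\<^esub> y \<in> carrier (padic_integers p)"
      unfolding s(2) using xy by (rule mulc)
    show "x \<oplus>\<^bsub>padic_integers p\<^esub> y = y \<oplus>\<^bsub>padic_integers p\<^esub> x"
      unfolding s(5) by (simp only: add.commute)
    show "x \<otimes>\<^bsub>padic_integers p\<^esub> y = y \<otimes>\<^bsub>padic_integers p\<^esub> x"
      unfolding s(2) by (simp only: mult.commute)
  next
    fix x assume x: "x \<in> carrier (padic_integers p)"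
    show "\<zero>\<^bsub>padic_integers p\<^esub> \<oplus>\<^bsub>padic_integers p\<^esub> x = x"
      unfolding s(4,5) by (simp only: add_0 id[OF x])
    show "\<one>\<^bsub>padic_integers p\<^esub> \<otimes>\<^bsub>padic_integers p\<^esub> x = x"
      unfolding s(2,3) by (simp only: mult_1 id[OF x])
  next
    fix x y z :: "nat \<Rightarrow> int"
    show "x \<oplus>\<^bsub>padic_integers p\<^esub> y \<oplus>\<^bsub>padic_integers p\<^esub> z =
          x \<oplus>\<^bsub>padic_integers p\<^esub> (y \<oplus>\<^bsub>padic_integers p\<^esub> z)"
      unfolding s(5) by (simp only: mod_add_left_eq mod_add_right_eq add.assoc)
    show "x \<otimes>\<^bsub>padic_integers p\<^esub> y \<otimes>\<^bsub>padic_integers p\<^esub> z =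
          x \<otimes>\<^bsub>padic_integers p\<^esub> (y \<otimes>\<^bsub>padic_integers p\<^esub> z)"
      unfolding s(2) by (simp only: mod_mult_left_eq mod_mult_right_eq mult.assoc)
    show "(x \<oplus>\<^bsub>padic_integers p\<^esub> y) \<otimes>\<^bsub>padic_integers p\<^esub> z =
          x \<otimes>\<^bsub>padic_integers p\<^esub> z \<oplus>\<^bsub>padic_integers p\<^esub> y \<otimes>\<^bsub>padic_integers p\<^esub> z"
      unfolding s(2,5)
      by (simp only: mod_mult_left_eq mod_add_left_eq mod_add_right_eq distrib_right)
  qed
qed


section \<open>Varieties\<close>

text \<open>
  Polynomials in the variables \<open>x\<^sub>1, \<dots>, x\<^sub>m\<close> are finitely supported maps from exponent
  vectors to coefficients, such that only the indices \<open>1, \<dots>, m\<close> occur in exponent vectors.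
\<close>

type_synonym 'c mpol = "(nat \<Rightarrow>\<^sub>0 nat) \<Rightarrow>\<^sub>0 'c"

definition polys_in :: "nat \<Rightarrow> 'c::zero mpol set" where
  "polys_in m = {P. \<forall>\<mu>\<in>Poly_Mapping.keys P. Poly_Mapping.keys \<mu> \<subseteq> {1..m}}"

text \<open>The value at \<open>x\<close> of the image of \<open>P\<close> under the coefficient map \<open>\<phi>\<close> into \<open>R\<close>.\<close>

definition eval_poly :: "('a, 'b) ring_scheme \<Rightarrow> ('c::zero \<Rightarrow> 'a) \<Rightarrow> 'c mpol \<Rightarrow> (nat \<Rightarrow> 'a) \<Rightarrow> 'a"
  where
  "eval_poly R \<phi> P x =
     (\<Oplus>\<^bsub>R\<^esub>\<mu>\<in>Poly_Mapping.keys P. \<phi> (Poly_Mapping.lookup P \<mu>) \<otimes>\<^bsub>R\<^esub>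
        (\<Otimes>\<^bsub>R\<^esub>i\<in>Poly_Mapping.keys \<mu>. x i [^]\<^bsub>R\<^esub> Poly_Mapping.lookup \<mu> i))"

lemma eval_poly_complex:
  "eval_poly complex_ring \<phi> P x =
     (\<Sum>\<mu>\<in>Poly_Mapping.keys P. \<phi> (Poly_Mapping.lookup P \<mu>) *
        (\<Prod>i\<in>Poly_Mapping.keys \<mu>. x i ^ Poly_Mapping.lookup \<mu> i))"
proof -
  interpret C: cring complex_ring by (rule cring_from_type_algebra)
  have s: "carrier complex_ring = UNIV" "\<zero>\<^bsub>complex_ring\<^esub> = 0" "\<one>\<^bsub>complex_ring\<^esub> = 1"
    "a \<otimes>\<^bsub>complex_ring\<^esub> b = a * b" "a \<oplus>\<^bsub>complex_ring\<^esub> b = a + b" for a b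
    by (simp_all add: ring_of_type_algebra_def)
  have pw: "a [^]\<^bsub>complex_ring\<^esub> (k :: nat) = a ^ k" for a k
    by (induction k) (simp_all add: s mult.commute)
  have pr: "(\<Otimes>\<^bsub>complex_ring\<^esub>i\<in>A. g i) = (\<Prod>i\<in>A. g i)" if "finite A" for A and g :: "nat \<Rightarrow> complex"
    using that by induction (simp_all add: s)
  have sm: "(\<Oplus>\<^bsub>complex_ring\<^esub>i\<in>A. g i) = (\<Sum>i\<in>A. g i)" if "finite A"
    for A and g :: "(nat \<Rightarrow>\<^sub>0 nat) \<Rightarrow> complex"
    using that by induction (simp_all add: s)
  show ?thesis
    by (simp add: eval_poly_def pw pr sm s)
qed

definition affine_space :: "('a, 'b) ring_scheme \<Rightarrow> nat \<Rightarrow> (nat \<Rightarrow> 'a) monoid" where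
  "affine_space R m = product_group {1..m} (\<lambda>i. add_monoid R)"

definition zero_locus ::
    "('a, 'b) ring_scheme \<Rightarrow> ('c::zero \<Rightarrow> 'a) \<Rightarrow> nat \<Rightarrow> 'c mpol set \<Rightarrow> (nat \<Rightarrow> 'a) set" where
  "zero_locus R \<phi> m \<P> =
     {x \<in> carrier (affine_space R m). \<forall>P\<in>\<P>. eval_poly R \<phi> P x = \<zero>\<^bsub>R\<^esub>}"

definition int_points ::
    "('a, 'b) ring_scheme \<Rightarrow> nat \<Rightarrow> int mpol set \<Rightarrow> (nat \<Rightarrow> 'a) set" where
  "int_points R m \<P> = zero_locus R (\<lambda>c. add_pow R c \<one>\<^bsub>R\<^esub>) m \<P>"

text \<open>
  The closed sets over the rationals: subsets of complex affine space cut out by polynomials with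
  rational coefficients. A closed set is irreducible over the rationals if it is nonempty and not
  the union of two proper subsets that are again closed over the rationals. Absolute
  irreducibility (irreducibility over the complex numbers) is a stronger condition.
\<close>

definition closed_over_rat :: "nat \<Rightarrow> (nat \<Rightarrow> complex) set \<Rightarrow> bool" where
  "closed_over_rat m A \<longleftrightarrow> (\<exists>\<P>\<subseteq>polys_in m. A = zero_locus complex_ring of_rat m \<P>)"

definition irreducible_over_rat :: "nat \<Rightarrow> (nat \<Rightarrow> complex) set \<Rightarrow> bool" where
  "irreducible_over_rat m V \<longleftrightarrow>
     closed_over_rat m V \<and> V \<noteq> {} \<and>
     (\<forall>A B. closed_over_rat m A \<longrightarrow> closed_over_rat m B \<longrightarrow> V = A \<union> B \<longrightarrow> V = A \<or> V = B)"

end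

(* Both chromatic numbers are compared through finite bounds k. By the de Bruijn-Erdos theorem a Cayley
   graph is k-colourable iff its finite subgraphs are, and a finite subgraph is a solution of finitely
   many integral polynomial equations together with the condition that the vertices are distinct. So
   it suffices to move such solutions between the complex numbers and the p-adic integers.
   A finitely generated domain of characteristic 0 maps to any algebraically closed field of
   characteristic 0 without killing a prescribed nonzero element. Applied to the coordinates of
   p-adic points this gives complex points; applied to the coordinates of complex points it gives
   points over the algebraic numbers. The latter lie in a field generated by one element theta,
   whose minimal polynomial f has a simple root modulo infinitely many primes p; by Hensel's lemma
   it then has a root in the p-adic integers, to which theta can be sent once p avoids finitely many
   denominators. *)

theory Submission
  imports Defs "HOL-Analysis.Function_Topology"
    "HOL-Library.Function_Algebras"
begin

section \<open>Finite colourings\<close>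

text \<open>Adjacency is transported in one direction only: a map that sends edges of a finite
  vertex set to edges lets a colouring be pulled back, so solutions have to be moved but
  non-solutions need not be preserved. The prime found for a finite complex subgraph depends on that
  subgraph, which is why the p-adic side is a supremum over all primes. The p-adic integers are a
  record and not a type, while the algebra of generated rings runs in type classes. They are
  therefore reached as a quotient: inside the ring of all integer sequences with pointwise
  operations, \<open>U\<close> consists of the compatible sequences, \<open>P\<close> of those
  congruent to zero, and \<open>U\<close> modulo \<open>U \<inter> P\<close> is Z_p. The
  homomorphism theorem is stated for such a pair, with vanishing on \<open>P\<close> in place of a
  quotient ring; the complex case is the pair \<open>UNIV\<close>, \<open>{0}\<close>. Its induction
  over the generators cannot carry a map alone. It carries an element outside \<open>P\<close> that
  the map must not kill, and trades it at each generator for one of the smaller ring.\<close>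

definition colourable :: "'v graph \<Rightarrow> nat \<Rightarrow> bool" where
  "colourable G k \<longleftrightarrow> (\<exists>c. c ` fst G \<subseteq> {..<k} \<and>
     (\<forall>x\<in>fst G. \<forall>y\<in>fst G. (x, y) \<in> snd G \<longrightarrow> c x \<noteq> c y))"

lemma chromatic_number_le_iff_colourable:
  assumes "irrefl (snd G)"
  shows "chromatic_number G \<le>o |{..<k}| \<longleftrightarrow> colourable G k"
proof
  assume le: "chromatic_number G \<le>o |{..<k}|"
  obtain P where P: "colour_classes G P" "chromatic_number G = |P|"
    using chromatic_number_attained[OF assms] by blast
  then obtain f where f: "inj_on f P" "f ` P \<subseteq> {..<k}"
    using le card_of_ordLeq[of P "{..<k}"] by auto
  have part: "partition_on (fst G) P"
    using P(1) by (simp add: colour_classes_def)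
  have "\<forall>x\<in>fst G. \<exists>C. C \<in> P \<and> x \<in> C"
    using partition_onD1[OF part] by blast
  then obtain cl where cl: "\<And>x. x \<in> fst G \<Longrightarrow> cl x \<in> P \<and> x \<in> cl x"
    by metis
  have "f (cl x) \<noteq> f (cl y)" if "x \<in> fst G" "y \<in> fst G" "(x, y) \<in> snd G" for x y
  proof
    assume "f (cl x) = f (cl y)"
    then have "cl x = cl y" using f(1) cl that by (auto dest: inj_onD)
    then have "x \<in> cl x" "y \<in> cl x" "cl x \<in> P" using cl that by metis+
    then show False using P(1) that(3) by (auto simp: colour_classes_def)
  qed
  then show "colourable G k"
    unfolding colourable_def using f(2) cl by (intro exI[of _ "f \<circ> cl"]) (auto simp: image_subset_iff)
next
  assume "colourable G k"
  then obtain c where c: "c ` fst G \<subseteq> {..<k}"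
    "\<And>x y. x \<in> fst G \<Longrightarrow> y \<in> fst G \<Longrightarrow> (x, y) \<in> snd G \<Longrightarrow> c x \<noteq> c y"
    unfolding colourable_def by blast
  \<comment> \<open>Indexed by the colours that occur, since a partition has no empty block.\<close>
  define P where "P = (\<lambda>i. {x \<in> fst G. c x = i}) ` (c ` fst G)"
  have "partition_on (fst G) P"
    by (rule partition_onI) (auto simp: P_def disjnt_def)
  then have "colour_classes G P"
    unfolding colour_classes_def using c(2) by (fastforce simp: P_def)
  then have "chromatic_number G \<le>o |P|" by (rule chromatic_number_le)
  also have "|P| \<le>o |c ` fst G|" unfolding P_def by (rule card_of_image)
  also have "|c ` fst G| \<le>o |{..<k}|" using c(1) by (rule card_of_mono1)
  finally show "chromatic_number G \<le>o |{..<k}|" .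
qed

text \<open>Tychonoff: the colourings of \<open>V\<close> with \<open>k\<close> colours form a
  compact space, being proper on one edge is a closed condition, and finitely many edges touch only
  finitely many vertices, so \<open>fin\<close> gives the finite intersection property.\<close>

theorem de_Bruijn_Erdos:
  fixes V :: "'v set"
  assumes fin: "\<And>W. finite W \<Longrightarrow> W \<subseteq> V \<Longrightarrow> colourable (W, E) k"
  shows "colourable (V, E) k"
proof (cases "V = {}")
  case True
  then show ?thesis by (simp add: colourable_def)
next
  case False
  then obtain v where "v \<in> V" by blast
  \<comment> \<open>A single vertex already needs a colour; colour 0 is then available as the
    default in \<open>c'\<close> below.\<close>
  then have k: "0 < k" using fin[of "{v}"] by (auto simp: colourable_def)
  define T where "T = product_topology (\<lambda>_. discrete_topology {..<k}) V"
  have top: "topspace T = (\<Pi>\<^sub>E x\<in>V. {..<k})" by (simp add: T_def)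
  have comp: "compact_space T"
    unfolding T_def
    by (simp add: compact_space_product_topology compact_space_discrete_topology)
  define A where "A e = {c \<in> topspace T. c (fst e) \<noteq> c (snd e)}" for e :: "'v \<times> 'v"
  define \<A> where "\<A> = A ` (E \<inter> V \<times> V)"
  have op: "openin T {c \<in> topspace T. c x = i}" if "x \<in> V" "i < k" for x i
  proof -
    have "continuous_map T (discrete_topology {..<k}) (\<lambda>c. c x)"
      unfolding T_def using that by (intro continuous_map_product_projection)
    from openin_continuous_map_preimage[OF this, of "{i}"] show ?thesis using that by simp
  qed
  have clos: "closedin T C" if CA: "C \<in> \<A>" for C
  proof -
    obtain x y where xy: "x \<in> V" "y \<in> V" "C = A (x, y)" using CA by (auto simp: \<A>_def)
    \<comment> \<open>The two ends share a colour exactly on a finite union of open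
      cylinders.\<close>
    have "C = topspace T - (\<Union>i<k. {c \<in> topspace T. c x = i} \<inter> {c \<in> topspace T. c y = i})"
      using xy by (auto simp: A_def top)
    moreover have "openin T (\<Union>i<k. {c \<in> topspace T. c x = i} \<inter> {c \<in> topspace T. c y = i})"
      using xy by (intro openin_Union ballI) (auto intro!: openin_Int op)
    ultimately show ?thesis by (simp add: closedin_diff)
  qed
  have fip: "topspace T \<inter> \<Inter>\<F> \<noteq> {}" if F: "finite \<F>" "\<F> \<subseteq> \<A>" for \<F>
  proof -
    obtain D where D: "D \<subseteq> E \<inter> V \<times> V" "finite D" "\<F> = A ` D"
      using finite_subset_image[OF F(1) F(2)[unfolded \<A>_def]] by blast
    define W where "W = fst ` D \<union> snd ` D"
    have W: "finite W" "W \<subseteq> V" using D by (auto simp: W_def)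
    obtain c where c: "c ` W \<subseteq> {..<k}" "\<And>x y. x \<in> W \<Longrightarrow> y \<in> W \<Longrightarrow> (x, y) \<in> E \<Longrightarrow> c x \<noteq> c y"
      using fin[OF W] unfolding colourable_def by auto
    define c' where "c' = (\<lambda>x\<in>V. if x \<in> W then c x else 0)"
    have "c' \<in> topspace T" using c(1) k by (auto simp: top c'_def image_subset_iff)
    moreover have "c' \<in> A e" if "e \<in> D" for e
    proof -
      have "fst e \<in> W" "snd e \<in> W" "e \<in> E" using that D by (auto simp: W_def)
      then show ?thesis using c(2)[of "fst e" "snd e"] W(2) \<open>c' \<in> topspace T\<close>
        by (auto simp: A_def c'_def)
    qed
    ultimately show ?thesis using D by blast
  qed
  have "topspace T \<inter> \<Inter>\<A> \<noteq> {}"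
    using comp clos fip unfolding compact_space_def compactin_fip by blast
  then obtain c where c: "c \<in> topspace T" "c \<in> \<Inter>\<A>" by blast
  have "c x \<noteq> c y" if "x \<in> V" "y \<in> V" "(x, y) \<in> E" for x y
  proof -
    have "A (x, y) \<in> \<A>" using that by (auto simp: \<A>_def)
    then have "c \<in> A (x, y)" using c(2) by blast
    then show ?thesis by (simp add: A_def)
  qed
  then show ?thesis
    unfolding colourable_def using c(1) by (intro exI[of _ c]) (auto simp: top)
qed

lemma colourable_mono_hom:
  assumes "colourable H k" and "f ` fst G \<subseteq> fst H"
    and "\<And>x y. x \<in> fst G \<Longrightarrow> y \<in> fst G \<Longrightarrow> (x, y) \<in> snd G \<Longrightarrow> (f x, f y) \<in> snd H"
  shows "colourable G k"
proof -
  obtain c where c: "c ` fst H \<subseteq> {..<k}"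
    "\<And>x y. x \<in> fst H \<Longrightarrow> y \<in> fst H \<Longrightarrow> (x, y) \<in> snd H \<Longrightarrow> c x \<noteq> c y"
    using assms(1) unfolding colourable_def by blast
  show ?thesis unfolding colourable_def
    using c assms(2,3) by (intro exI[of _ "c \<circ> f"]) (auto simp: image_subset_iff)
qed

section \<open>Cardinals compared through finite bounds\<close>

lemma finite_card_ordIso_nat:
  assumes "Card_order r" and "finite_card r"
  obtains k :: nat where "r =o |{..<k}|"
proof
  have "finite (Field r)" using assms(2) by (simp add: cfinite_def)
  then have "|Field r| =o |{..<card (Field r)}|"
    using ex_bij_betw_finite_nat card_of_ordIso by (metis atLeast0LessThan)
  then show "r =o |{..<card (Field r)}|"
    using card_of_Field_ordIso[OF assms(1)] ordIso_symmetric ordIso_transitive by blast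
qed

text \<open>A finite cardinal is the least of its finite bounds, so equal bounds mean equal
  cardinals as soon as a bound exists. Infinite cardinals have no finite bound and could not be told
  apart, hence the finiteness assumption.\<close>

lemma ordIso_if_same_finite_bounds:
  assumes "Card_order a" and "Card_order b"
    and "\<And>k::nat. a \<le>o |{..<k}| \<longleftrightarrow> b \<le>o |{..<k}|"
    and "finite_card a \<or> finite_card b"
  shows "a =o b"
proof -
  have fin: "finite_card r" if "Card_order r" "r \<le>o |{..<k}|" for r :: "'c rel" and k :: nat
  proof -
    have "|Field r| \<le>o |{..<k}|"
      using that card_of_Field_ordIso ordIso_ordLeq_trans by blast
    then have "finite (Field r)" using card_of_ordLeq_finite by blast
    then show ?thesis by (simp add: cfinite_def)
  qed
  have "finite_card a \<and> finite_card b"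
  proof (rule disjE[OF assms(4)])
    assume a: "finite_card a"
    obtain k :: nat where "a =o |{..<k}|" by (rule finite_card_ordIso_nat[OF assms(1) a])
    then have "b \<le>o |{..<k}|" using assms(3) ordIso_imp_ordLeq by blast
    then show ?thesis using a fin[OF assms(2)] by blast
  next
    assume b: "finite_card b"
    obtain k :: nat where "b =o |{..<k}|" by (rule finite_card_ordIso_nat[OF assms(2) b])
    then have "a \<le>o |{..<k}|" using assms(3) ordIso_imp_ordLeq by blast
    then show ?thesis using b fin[OF assms(1)] by blast
  qed
  then obtain k l :: nat where k: "a =o |{..<k}|" and l: "b =o |{..<l}|"
    using finite_card_ordIso_nat assms(1,2) by metis
  have "b \<le>o |{..<k}|" using assms(3) k ordIso_imp_ordLeq by blast
  then have "b \<le>o a" using k ordIso_symmetric ordLeq_ordIso_trans by blast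
  moreover have "a \<le>o |{..<l}|" using assms(3) l ordIso_imp_ordLeq by blast
  then have "a \<le>o b" using l ordIso_symmetric ordLeq_ordIso_trans by blast
  ultimately show ?thesis by (simp add: ordIso_iff_ordLeq)
qed

section \<open>Homomorphisms from finitely generated domains\<close>

text \<open>Subrings stay sets inside one ambient type because the rings that occur,
  \<open>subring_set hull T\<close> and \<open>adjoin A b\<close>, depend on the points at hand. The
  predicate is stable under intersections, so \<open>hull\<close> yields the generated
  subring.\<close>

definition subring_set :: "'a::comm_ring_1 set \<Rightarrow> bool" where
  "subring_set A \<longleftrightarrow> 1 \<in> A \<and> (\<forall>x\<in>A. \<forall>y\<in>A. x - y \<in> A \<and> x * y \<in> A)"

context
  fixes A :: "'a::comm_ring_1 set"
  assumes A: "subring_set A"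
begin

lemma subring_set_1: "1 \<in> A"
  and subring_set_diff: "x \<in> A \<Longrightarrow> y \<in> A \<Longrightarrow> x - y \<in> A"
  and subring_set_mult: "x \<in> A \<Longrightarrow> y \<in> A \<Longrightarrow> x * y \<in> A"
  using A by (auto simp: subring_set_def)

lemma subring_set_0: "0 \<in> A"
  using subring_set_diff[OF subring_set_1 subring_set_1] by simp

lemma subring_set_uminus: "x \<in> A \<Longrightarrow> - x \<in> A"
  using subring_set_diff[OF subring_set_0] by simp

lemma subring_set_add: "x \<in> A \<Longrightarrow> y \<in> A \<Longrightarrow> x + y \<in> A"
  using subring_set_diff[OF _ subring_set_uminus] by fastforce

lemma subring_set_sum: "(\<And>i. i \<in> I \<Longrightarrow> f i \<in> A) \<Longrightarrow> sum f I \<in> A"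
  by (induction I rule: infinite_finite_induct) (auto intro: subring_set_0 subring_set_add)

lemma subring_set_prod: "(\<And>i. i \<in> I \<Longrightarrow> f i \<in> A) \<Longrightarrow> prod f I \<in> A"
  by (induction I rule: infinite_finite_induct) (auto intro: subring_set_1 subring_set_mult)

lemma subring_set_power: "x \<in> A \<Longrightarrow> x ^ n \<in> A"
  by (induction n) (auto intro: subring_set_1 subring_set_mult)

lemma subring_set_of_nat: "of_nat n \<in> A"
  by (induction n) (auto intro: subring_set_0 subring_set_1 subring_set_add)

lemma subring_set_of_int: "of_int n \<in> A"
  by (cases n rule: int_cases2) (auto intro: subring_set_of_nat subring_set_uminus)

end

lemmas subring_set_intros = subring_set_0 subring_set_1 subring_set_diff subring_set_uminus
  subring_set_add subring_set_mult subring_set_sum subring_set_prod subring_set_power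
  subring_set_of_nat subring_set_of_int

lemma subring_set_hull: "subring_set (subring_set hull T)"
  by (rule hull_in) (auto simp: subring_set_def)

definition polys_over :: "'a::comm_ring_1 set \<Rightarrow> 'a poly set" where
  "polys_over A = {f. \<forall>i. coeff f i \<in> A}"

lemma coeff_polys_over: "f \<in> polys_over A \<Longrightarrow> coeff f i \<in> A"
  by (simp add: polys_over_def)

context
  fixes A :: "'a::comm_ring_1 set"
  assumes A: "subring_set A"
begin

lemma subring_set_polys_over: "subring_set (polys_over A)"
  unfolding subring_set_def polys_over_def
  by (auto simp: coeff_mult coeff_1 intro!: subring_set_intros[OF A])

lemma monom_polys_over: "a \<in> A \<Longrightarrow> monom a n \<in> polys_over A"
  by (auto simp: polys_over_def intro: subring_set_0[OF A])

lemma const_polys_over: "a \<in> A \<Longrightarrow> [:a:] \<in> polys_over A"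
  using monom_polys_over[of a 0] by (simp add: monom_0)

lemma smult_polys_over: "a \<in> A \<Longrightarrow> f \<in> polys_over A \<Longrightarrow> smult a f \<in> polys_over A"
  by (auto simp: polys_over_def intro: subring_set_mult[OF A])

lemma poly_polys_over:
  assumes "subring_set B" "A \<subseteq> B" "b \<in> B" "f \<in> polys_over A"
  shows "poly f b \<in> B"
  unfolding poly_altdef using assms
  by (auto intro!: subring_set_intros[OF assms(1)] dest: coeff_polys_over)

text \<open>The leading coefficient of \<open>g\<close> need not be invertible in \<open>A\<close>,
  so \<open>f\<close> is first multiplied by a power of it. The degree of \<open>q\<close> is
  bounded explicitly: in a ring with zero divisors, such as integer sequences, the bound cannot be
  read off the equation.\<close>

lemma pseudo_division_over:
  assumes g: "g \<in> polys_over A" "g \<noteq> 0" and f: "f \<in> polys_over A"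
  obtains k q r where "q \<in> polys_over A" "r \<in> polys_over A"
    "smult (lead_coeff g ^ k) f = q * g + r" "r = 0 \<or> degree r < degree g"
    "degree q \<le> degree f - degree g"
proof -
  note S = subring_set_intros[OF subring_set_polys_over]
  have "\<exists>k q r. q \<in> polys_over A \<and> r \<in> polys_over A \<and>
    smult (lead_coeff g ^ k) f = q * g + r \<and> (r = 0 \<or> degree r < degree g) \<and>
    degree q \<le> degree f - degree g"
    if "f = 0 \<or> degree f < n" "f \<in> polys_over A" for n f
    using that
  proof (induction n arbitrary: f)
    case 0
    then show ?case
      by (intro exI[of _ 0] exI[of _ "0 :: 'a poly"]) (auto intro: S subring_set_0[OF A])
  next
    case (Suc n)
    show ?case
    proof (cases "f = 0 \<or> degree f < degree g")
      case True
      then show ?thesis using Suc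
        by (intro exI[of _ 0] exI[of _ "0 :: 'a poly"] exI[of _ f]) (auto intro: S)
    next
      case False
      define c where "c = lead_coeff g"
      define w where "w = monom (lead_coeff f) (degree f - degree g)"
      \<comment> \<open>The top term of \<open>smult c f\<close> is cancelled by a multiple of
        \<open>g\<close>; the induction continues with \<open>f1\<close> and costs one more power of
        \<open>c\<close>.\<close>
      define f1 where "f1 = smult c f - w * g"
      have cA: "c \<in> A" using g by (auto simp: c_def coeff_polys_over)
      have w: "w \<in> polys_over A" using Suc.prems
        by (simp add: w_def coeff_polys_over monom_polys_over)
      have f1A: "f1 \<in> polys_over A"
        using w g Suc.prems cA by (auto simp: f1_def intro!: S smult_polys_over)
      have dw: "degree w \<le> degree f - degree g" by (auto simp: w_def degree_monom_le)
      have "degree (w * g) \<le> degree f"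
        using degree_mult_le[of w g] dw False by linarith
      then have d1: "degree f1 \<le> degree f"
        unfolding f1_def by (intro degree_diff_le) (auto intro: degree_smult_le)
      have "coeff (w * g) (degree f) = coeff (w * g) ((degree f - degree g) + degree g)"
        using False by simp
      also have "\<dots> = lead_coeff f * c"
        unfolding w_def c_def by (subst add.commute) (simp add: coeff_monom_mult)
      finally have "coeff f1 (degree f) = 0" by (simp add: f1_def c_def)
      then have f1: "f1 = 0 \<or> degree f1 < degree f"
        using d1 by (metis eq_zero_or_degree_less)
      then have "f1 = 0 \<or> degree f1 < n" using Suc.prems False by auto
      from Suc.IH[OF this f1A] obtain k q r where k: "q \<in> polys_over A" "r \<in> polys_over A"
        "smult (c ^ k) f1 = q * g + r" "r = 0 \<or> degree r < degree g"
        "degree q \<le> degree f1 - degree g" unfolding c_def by blast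
      have "smult (c ^ Suc k) f = smult (c ^ k) f1 + smult (c ^ k) (w * g)"
        by (simp add: f1_def smult_diff_right mult.commute)
      also have "\<dots> = (q + smult (c ^ k) w) * g + r"
        using k(3) by (simp add: algebra_simps)
      finally have eq: "smult (c ^ Suc k) f = (q + smult (c ^ k) w) * g + r" .
      have "degree (q + smult (c ^ k) w) \<le> degree f - degree g"
      proof (rule degree_add_le)
        show "degree q \<le> degree f - degree g" using k(5) d1 by linarith
        show "degree (smult (c ^ k) w) \<le> degree f - degree g"
          using degree_smult_le dw order_trans by blast
      qed
      then show ?thesis
        using eq k w cA unfolding c_def
        by (intro exI[of _ "Suc k"] exI[of _ "q + smult (c ^ k) w"] exI[of _ r])
           (auto simp: c_def intro!: S smult_polys_over subring_set_intros[OF A])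
    qed
  qed
  from this[of f "Suc (degree f)"] f that show thesis by blast
qed

end

section \<open>Homomorphisms defined on a subring\<close>

definition ring_hom_on :: "'a::comm_ring_1 set \<Rightarrow> ('a \<Rightarrow> 'b::comm_ring_1) \<Rightarrow> bool" where
  "ring_hom_on A h \<longleftrightarrow> h 1 = 1 \<and> (\<forall>x\<in>A. \<forall>y\<in>A. h (x + y) = h x + h y \<and> h (x * y) = h x * h y)"

lemma ring_hom_on_1: "ring_hom_on A h \<Longrightarrow> h 1 = 1"
  and ring_hom_on_add: "ring_hom_on A h \<Longrightarrow> x \<in> A \<Longrightarrow> y \<in> A \<Longrightarrow> h (x + y) = h x + h y"
  and ring_hom_on_mult: "ring_hom_on A h \<Longrightarrow> x \<in> A \<Longrightarrow> y \<in> A \<Longrightarrow> h (x * y) = h x * h y"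
  by (auto simp: ring_hom_on_def)

context
  fixes A :: "'a::comm_ring_1 set" and h :: "'a \<Rightarrow> 'b::comm_ring_1"
  assumes A: "subring_set A" and h: "ring_hom_on A h"
begin

lemma ring_hom_on_0: "h 0 = 0"
  using ring_hom_on_add[OF h, of 0 0] subring_set_0[OF A] by simp

lemma ring_hom_on_uminus:
  assumes "x \<in> A" shows "h (- x) = - h x"
proof -
  have "h x + h (- x) = 0"
    using ring_hom_on_add[OF h, of x "- x"] assms subring_set_uminus[OF A] ring_hom_on_0 by simp
  then show ?thesis by (simp add: add_eq_0_iff)
qed

lemma ring_hom_on_diff: "x \<in> A \<Longrightarrow> y \<in> A \<Longrightarrow> h (x - y) = h x - h y"
  using ring_hom_on_add[OF h, of x "- y"] ring_hom_on_uminus subring_set_uminus[OF A] by simp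

lemma ring_hom_on_power: "x \<in> A \<Longrightarrow> h (x ^ n) = h x ^ n"
  by (induction n) (auto simp: ring_hom_on_1[OF h] ring_hom_on_mult[OF h] subring_set_power[OF A])

lemma ring_hom_on_sum: "(\<And>i. i \<in> I \<Longrightarrow> f i \<in> A) \<Longrightarrow> h (sum f I) = (\<Sum>i\<in>I. h (f i))"
  by (induction I rule: infinite_finite_induct)
     (auto simp: ring_hom_on_0 ring_hom_on_add[OF h] subring_set_sum[OF A])

lemma ring_hom_on_prod: "(\<And>i. i \<in> I \<Longrightarrow> f i \<in> A) \<Longrightarrow> h (prod f I) = (\<Prod>i\<in>I. h (f i))"
  by (induction I rule: infinite_finite_induct)
     (auto simp: ring_hom_on_1[OF h] ring_hom_on_mult[OF h] subring_set_prod[OF A])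

lemma ring_hom_on_of_nat: "h (of_nat n) = of_nat n"
  by (induction n) (auto simp: ring_hom_on_0 ring_hom_on_1[OF h] ring_hom_on_add[OF h] subring_set_intros[OF A])

lemma ring_hom_on_of_int: "h (of_int n) = of_int n"
  by (cases n rule: int_cases2)
     (auto simp: ring_hom_on_of_nat ring_hom_on_uminus subring_set_of_nat[OF A])

lemma map_poly_ring_hom_on: "ring_hom_on (polys_over A) (map_poly h)"
  unfolding ring_hom_on_def
proof (intro conjI ballI)
  show "map_poly h 1 = 1"
    by (simp add: map_poly_1 ring_hom_on_1[OF h])
  fix f g assume fg: "f \<in> polys_over A" "g \<in> polys_over A"
  show "map_poly h (f + g) = map_poly h f + map_poly h g"
    using fg by (intro poly_eqI) (simp add: coeff_map_poly ring_hom_on_0 ring_hom_on_add[OF h] coeff_polys_over)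
  show "map_poly h (f * g) = map_poly h f * map_poly h g"
  proof (rule poly_eqI)
    fix n
    have "h (\<Sum>i\<le>n. coeff f i * coeff g (n - i)) = (\<Sum>i\<le>n. h (coeff f i * coeff g (n - i)))"
      using fg by (intro ring_hom_on_sum) (auto intro: subring_set_mult[OF A] coeff_polys_over)
    also have "\<dots> = (\<Sum>i\<le>n. h (coeff f i) * h (coeff g (n - i)))"
      using fg by (intro sum.cong ring_hom_on_mult[OF h]) (auto intro: coeff_polys_over)
    finally show "coeff (map_poly h (f * g)) n = coeff (map_poly h f * map_poly h g) n"
      by (simp add: coeff_map_poly ring_hom_on_0 coeff_mult)
  qed
qed

end

definition adjoin :: "'a::comm_ring_1 set \<Rightarrow> 'a \<Rightarrow> 'a set" where
  "adjoin A b = (\<lambda>f. poly f b) ` polys_over A"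

lemma subring_set_adjoin:
  assumes "subring_set A"
  shows "subring_set (adjoin A b)"
  unfolding subring_set_def
proof (intro conjI ballI)
  note S = subring_set_intros[OF subring_set_polys_over[OF assms]]
  show "1 \<in> adjoin A b"
    unfolding adjoin_def using S(2) by (intro image_eqI[of _ _ 1]) auto
  fix x y assume "x \<in> adjoin A b" "y \<in> adjoin A b"
  then obtain f g where fg: "f \<in> polys_over A" "g \<in> polys_over A" "x = poly f b" "y = poly g b"
    unfolding adjoin_def by blast
  show "x - y \<in> adjoin A b"
    unfolding adjoin_def using fg by (intro image_eqI[of _ _ "f - g"]) (auto intro: S)
  show "x * y \<in> adjoin A b"
    unfolding adjoin_def using fg by (intro image_eqI[of _ _ "f * g"]) (auto intro: S)
qed

lemma subset_adjoin: "subring_set A \<Longrightarrow> insert b A \<subseteq> adjoin A b"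
proof -
  assume A: "subring_set A"
  have "b \<in> adjoin A b"
    unfolding adjoin_def using monom_polys_over[OF A subring_set_1[OF A], of 1]
    by (intro image_eqI[of _ _ "monom 1 1"]) (auto simp: poly_monom)
  moreover have "x \<in> adjoin A b" if "x \<in> A" for x
    unfolding adjoin_def using const_polys_over[OF A that] by (intro image_eqI[of _ _ "[:x:]"]) auto
  ultimately show ?thesis by blast
qed

section \<open>Extension of homomorphisms modulo a prime ideal\<close>

text \<open>Primality is only required for products of elements of \<open>U\<close>, so that \<open>P\<close> can be the
  kernel of a map from \<open>U\<close> to a domain.\<close>

locale prime_ideal_on =
  fixes U P :: "'a::comm_ring_1 set"
  assumes subring_U: "subring_set U"
    and P_0: "0 \<in> P"
    and P_add: "x \<in> P \<Longrightarrow> y \<in> P \<Longrightarrow> x + y \<in> P"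
    and P_mult: "x \<in> P \<Longrightarrow> a * x \<in> P"
    and P_1: "1 \<notin> P"
    and P_prime: "x \<in> U \<Longrightarrow> y \<in> U \<Longrightarrow> x * y \<in> P \<Longrightarrow> x \<in> P \<or> y \<in> P"
begin

lemma P_mult': "x \<in> P \<Longrightarrow> x * a \<in> P"
  using P_mult[of x a] by (simp add: mult.commute)

lemma P_uminus: "x \<in> P \<Longrightarrow> - x \<in> P"
  using P_mult[of x "- 1"] by simp

lemma P_diff: "x \<in> P \<Longrightarrow> y \<in> P \<Longrightarrow> x - y \<in> P"
  using P_add[of x "- y"] P_uminus by simp

lemma P_sum: "(\<And>i. i \<in> I \<Longrightarrow> f i \<in> P) \<Longrightarrow> sum f I \<in> P"
  by (induction I rule: infinite_finite_induct) (auto intro: P_0 P_add)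

lemma P_power: "x \<in> U \<Longrightarrow> x ^ n \<in> P \<Longrightarrow> x \<in> P"
  using P_1 P_prime subring_set_power[OF subring_U] by (induction n) auto

lemma P_prod: "finite I \<Longrightarrow> (\<And>i. i \<in> I \<Longrightarrow> f i \<in> U - P) \<Longrightarrow> prod f I \<notin> P"
proof (induction I rule: finite_induct)
  case empty
  then show ?case using P_1 by simp
next
  case (insert i I)
  have "prod f I \<in> U" using insert by (intro subring_set_prod[OF subring_U]) auto
  then show ?case using insert P_prime[of "f i" "prod f I"] by auto
qed

text \<open>Sending \<open>b\<close> to \<open>\<beta>\<close> must respect the relations of
  \<open>b\<close> modulo \<open>P\<close>, which is what \<open>root\<close> demands. Two
  polynomials with the same value at \<open>b\<close> differ by such a relation, so the choice made
  by \<open>rep\<close> does not matter. Asking for relations modulo \<open>P\<close>, and not only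
  exact ones, makes \<open>h'\<close> vanish on \<open>P\<close>.\<close>

lemma induced_hom:
  fixes h :: "'a \<Rightarrow> 'k::comm_ring_1"
  assumes A: "subring_set A" and h: "ring_hom_on A h"
    and root: "\<And>f. f \<in> polys_over A \<Longrightarrow> poly f b \<in> P \<Longrightarrow> poly (map_poly h f) \<beta> = 0"
  obtains h' where "ring_hom_on (adjoin A b) h'" "\<And>x. x \<in> adjoin A b \<Longrightarrow> x \<in> P \<Longrightarrow> h' x = 0"
    "\<And>f. f \<in> polys_over A \<Longrightarrow> h' (poly f b) = poly (map_poly h f) \<beta>"
proof -
  note S = subring_set_intros[OF subring_set_polys_over[OF A]]
  note H = map_poly_ring_hom_on[OF A h]
  define rep where "rep x = (SOME f. f \<in> polys_over A \<and> poly f b = x)" for x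
  define h' where "h' x = poly (map_poly h (rep x)) \<beta>" for x
  have h': "h' (poly f b) = poly (map_poly h f) \<beta>" if f: "f \<in> polys_over A" for f
  proof -
    have r: "rep (poly f b) \<in> polys_over A \<and> poly (rep (poly f b)) b = poly f b"
      unfolding rep_def by (rule someI[of _ f]) (use f in auto)
    have "poly (map_poly h (rep (poly f b) - f)) \<beta> = 0"
      using r f by (intro root S) (auto simp: P_0)
    then show ?thesis
      using r f by (simp add: h'_def ring_hom_on_diff[OF subring_set_polys_over[OF A] H])
  qed
  show thesis
  proof
    show "ring_hom_on (adjoin A b) h'"
      unfolding ring_hom_on_def
    proof (intro conjI ballI)
      show "h' 1 = 1"
        using h'[of 1] S(2) by (simp add: ring_hom_on_1[OF H])
      fix x y assume "x \<in> adjoin A b" "y \<in> adjoin A b"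
      then obtain f g where fg: "f \<in> polys_over A" "g \<in> polys_over A" "x = poly f b" "y = poly g b"
        unfolding adjoin_def by blast
      show "h' (x + y) = h' x + h' y"
        using h'[of "f + g"] fg S(5)[of f g] by (simp add: ring_hom_on_add[OF H] h')
      show "h' (x * y) = h' x * h' y"
        using h'[of "f * g"] fg S(6)[of f g] by (simp add: ring_hom_on_mult[OF H] h')
    qed
    show "h' x = 0" if "x \<in> adjoin A b" "x \<in> P" for x
      using that root h' by (auto simp: adjoin_def)
    show "h' (poly f b) = poly (map_poly h f) \<beta>" if "f \<in> polys_over A" for f
      using that by (rule h')
  qed
qed

text \<open>By \<open>tr\<close>, \<open>b\<close> is transcendental over \<open>A\<close> modulo
  \<open>P\<close>, so any \<open>\<beta>\<close> may serve as the image of \<open>b\<close>. It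
  only has to avoid the finitely many roots of the image of \<open>g\<close>, which is a nonzero
  polynomial once \<open>h\<close> does not kill a chosen coefficient of \<open>g\<close>.\<close>

lemma hom_extension_transcendental:
  assumes A: "subring_set A"
    and tr: "\<And>f i. f \<in> polys_over A \<Longrightarrow> poly f b \<in> P \<Longrightarrow> coeff f i \<in> P"
    and s: "s \<in> adjoin A b" "s \<notin> P"
  shows "\<exists>t\<in>A - P. \<forall>h :: 'a \<Rightarrow> 'k::field_char_0.
    ring_hom_on A h \<and> (\<forall>x\<in>A \<inter> P. h x = 0) \<and> h t \<noteq> 0 \<longrightarrow>
    (\<exists>h' :: 'a \<Rightarrow> 'k. ring_hom_on (adjoin A b) h' \<and> (\<forall>x\<in>adjoin A b \<inter> P. h' x = 0) \<and> h' s \<noteq> 0)"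
proof -
  obtain g where g: "g \<in> polys_over A" "s = poly g b" using s unfolding adjoin_def by blast
  have "\<exists>i. coeff g i \<notin> P"
  proof (rule ccontr)
    assume "\<nexists>i. coeff g i \<notin> P"
    then have "poly g b \<in> P" unfolding poly_altdef by (auto intro!: P_sum P_mult')
    then show False using s g by simp
  qed
  then obtain i where i: "coeff g i \<notin> P" ..
  show ?thesis
  proof (intro bexI[of _ "coeff g i"] allI impI)
    show "coeff g i \<in> A - P" using i g(1) coeff_polys_over by blast
    fix h :: "'a \<Rightarrow> 'k"
    assume h: "ring_hom_on A h \<and> (\<forall>x\<in>A \<inter> P. h x = 0) \<and> h (coeff g i) \<noteq> 0"
    then have hh: "ring_hom_on A h" by blast
    have "coeff (map_poly h g) i \<noteq> 0" using h by (simp add: coeff_map_poly ring_hom_on_0[OF A hh])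
    then have "map_poly h g \<noteq> 0" by auto
    then have "finite {\<beta>. poly (map_poly h g) \<beta> = 0}" by (rule poly_roots_finite)
    then have "{\<beta>. poly (map_poly h g) \<beta> = 0} \<noteq> UNIV" using infinite_UNIV_char_0 by metis
    then obtain \<beta> where \<beta>: "poly (map_poly h g) \<beta> \<noteq> 0" by blast
    have "map_poly h f = 0" if "f \<in> polys_over A" "poly f b \<in> P" for f
      using tr[OF that] that h
      by (intro poly_eqI) (auto simp: coeff_map_poly ring_hom_on_0[OF A hh] coeff_polys_over)
    then have "poly (map_poly h f) \<beta> = 0" if "f \<in> polys_over A" "poly f b \<in> P" for f
      using that by simp
    from induced_hom[OF A hh this] obtain h' where "ring_hom_on (adjoin A b) h'"
      "\<And>x. x \<in> adjoin A b \<Longrightarrow> x \<in> P \<Longrightarrow> h' x = 0"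
      "\<And>f. f \<in> polys_over A \<Longrightarrow> h' (poly f b) = poly (map_poly h f) \<beta>"
      by blast
    then show "\<exists>h' :: 'a \<Rightarrow> 'k. ring_hom_on (adjoin A b) h' \<and> (\<forall>x\<in>adjoin A b \<inter> P. h' x = 0) \<and> h' s \<noteq> 0"
      using \<beta> g by (intro exI[of _ h']) auto
  qed
qed

text \<open>Here \<open>b\<close> is algebraic over \<open>A\<close> modulo \<open>P\<close>, and
  \<open>\<beta>\<close> must be a root of the image of a minimal relation \<open>f\<close>. The
  witness is a product \<open>t * c\<close>. Its factor \<open>c\<close>, the leading coefficient of
  \<open>f\<close>, keeps the degree of the image and lets remainders be taken; its factor
  \<open>t\<close> is a multiple of \<open>s\<close> modulo \<open>P\<close>, so that
  \<open>h' s = 0\<close> would force \<open>h t = 0\<close>.\<close>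

lemma hom_extension_algebraic:
  assumes A: "subring_set A" "A \<subseteq> U" and b: "b \<in> U"
    and alg: "f0 \<in> polys_over A" "poly f0 b \<in> P" "coeff f0 i0 \<notin> P"
    and s: "s \<in> adjoin A b" "s \<notin> P"
  shows "\<exists>t\<in>A - P. \<forall>h :: 'a \<Rightarrow> 'k::alg_closed_field.
    ring_hom_on A h \<and> (\<forall>x\<in>A \<inter> P. h x = 0) \<and> h t \<noteq> 0 \<longrightarrow>
    (\<exists>h' :: 'a \<Rightarrow> 'k. ring_hom_on (adjoin A b) h' \<and> (\<forall>x\<in>adjoin A b \<inter> P. h' x = 0) \<and> h' s \<noteq> 0)"
proof -
  note S = subring_set_intros[OF subring_set_polys_over[OF A(1)]]
  note SU = subring_set_intros[OF subring_U]
  have pU: "poly f b \<in> U" if "f \<in> polys_over A" for f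
    using poly_polys_over[OF A(1) subring_U A(2) b that] .
  have cU: "coeff f i \<in> U" if "f \<in> polys_over A" for f i
    using coeff_polys_over[OF that] A(2) by blast
  \<comment> \<open>Dropping a top term whose coefficient is in \<open>P\<close> keeps the value at
    \<open>b\<close> modulo \<open>P\<close>. This is how the polynomials of least degree below are
    seen to have leading coefficients outside \<open>P\<close>.\<close>
  have lower: "f - monom (lead_coeff f) (degree f) \<in> polys_over A"
    "degree f > 0 \<Longrightarrow> degree (f - monom (lead_coeff f) (degree f)) < degree f"
    "lead_coeff f \<in> P \<Longrightarrow> poly f b - poly (f - monom (lead_coeff f) (degree f)) b \<in> P"
    if "f \<in> polys_over A" for f
  proof -
    show "f - monom (lead_coeff f) (degree f) \<in> polys_over A"
      using that by (auto intro!: S monom_polys_over[OF A(1)] simp: coeff_polys_over)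
    show "degree (f - monom (lead_coeff f) (degree f)) < degree f" if "degree f > 0"
    proof -
      have "degree (f - monom (lead_coeff f) (degree f)) \<le> degree f"
        by (intro degree_diff_le) (auto simp: degree_monom_le)
      moreover have "coeff (f - monom (lead_coeff f) (degree f)) (degree f) = 0" by simp
      ultimately show ?thesis using that
        by (metis degree_0 eq_zero_or_degree_less)
    qed
    show "poly f b - poly (f - monom (lead_coeff f) (degree f)) b \<in> P" if "lead_coeff f \<in> P"
      using that by (simp add: poly_monom P_mult')
  qed
  \<comment> \<open>Relations of \<open>b\<close> modulo \<open>P\<close> that are not trivial
    modulo \<open>P\<close>. One of least degree replaces the minimal polynomial over the fraction
    field of \<open>A\<close> modulo \<open>P\<close>.\<close>
  define Z where "Z f \<longleftrightarrow> f \<in> polys_over A \<and> poly f b \<in> P \<and> (\<exists>i. coeff f i \<notin> P)" for f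
  have "Z f0" using alg by (auto simp: Z_def)
  then obtain f where f: "Z f" "\<And>g. Z g \<Longrightarrow> degree f \<le> degree g"
    using ex_has_least_nat[of Z f0 degree] by blast
  define c where "c = lead_coeff f"
  have fA: "f \<in> polys_over A" "poly f b \<in> P" using f(1) by (auto simp: Z_def)
  have small: "coeff r i \<in> P" if "r \<in> polys_over A" "poly r b \<in> P" "r = 0 \<or> degree r < degree f" for r i
    using f(2)[of r] that P_0 unfolding Z_def by (metis coeff_0 not_le)
  have cP: "c \<notin> P"
  proof
    assume c: "c \<in> P"
    define f1 where "f1 = f - monom (lead_coeff f) (degree f)"
    obtain i where i: "coeff f i \<notin> P" using f(1) by (auto simp: Z_def)
    then have ne: "i \<noteq> degree f" using c by (auto simp: c_def)
    moreover have "coeff f i \<noteq> 0" using i P_0 by metis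
    ultimately have "degree f > 0" using le_degree[of f i] by linarith
    then have "degree f1 < degree f" unfolding f1_def using lower(2) fA by blast
    moreover have "poly f1 b = poly f b - (poly f b - poly f1 b)" by simp
    then have "poly f1 b \<in> P" unfolding f1_def
      using lower(3)[OF fA(1)] c fA(2) P_diff unfolding c_def by metis
    ultimately have "coeff f1 i \<in> P" using small[of f1 i] lower(1)[OF fA(1)] by (simp add: f1_def)
    then show False using i ne by (simp add: f1_def)
  qed
  have c: "c \<in> A" "c \<in> U" unfolding c_def using fA coeff_polys_over cU by auto
  have f0: "f \<noteq> 0" using cP P_0 by (auto simp: c_def)
  have degf: "degree f > 0"
  proof (rule ccontr)
    assume "\<not> degree f > 0"
    then have "f = [:c:]" unfolding c_def by (metis degree_0_id gr0I)
    then have "poly f b = c" by simp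
    then show False using fA cP by simp
  qed
  obtain g where g: "g \<in> polys_over A" "s = poly g b" using s unfolding adjoin_def by blast
  \<comment> \<open>Polynomials whose value at \<open>b\<close> lies outside \<open>P\<close> and is
    a multiple of \<open>s\<close> modulo \<open>P\<close>. A constant one is the wanted element
    \<open>t\<close>.\<close>
  define J where "J u \<longleftrightarrow> u \<in> polys_over A \<and> poly u b \<notin> P \<and>
    (\<exists>q\<in>polys_over A. poly u b - poly q b * s \<in> P)" for u
  obtain k q r where gf: "q \<in> polys_over A" "r \<in> polys_over A" "smult (c ^ k) g = q * f + r"
    "r = 0 \<or> degree r < degree f"
    using pseudo_division_over[OF A(1) fA(1) f0 g(1)] unfolding c_def by metis
  have r_eq: "c ^ k * s = poly q b * poly f b + poly r b"
    using arg_cong[OF gf(3), of "\<lambda>p. poly p b"] g(2) by simp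
  have rP: "poly r b \<notin> P"
  proof
    assume "poly r b \<in> P"
    then have "c ^ k * s \<in> P" unfolding r_eq using fA by (auto intro: P_add P_mult)
    then show False using P_prime[of "c ^ k" s] P_power[of c k] c cP s g pU by (auto intro: SU)
  qed
  \<comment> \<open>Replacing \<open>g\<close> by its remainder gives a member of \<open>J\<close>
    of degree below that of \<open>f\<close>.\<close>
  have Jr: "J r"
  proof -
    have "poly r b - poly [:c ^ k:] b * s = - (poly q b * poly f b)"
      using r_eq by (simp add: algebra_simps)
    then have "poly r b - poly [:c ^ k:] b * s \<in> P" using fA P_mult P_uminus by metis
    moreover have "[:c ^ k:] \<in> polys_over A"
      using c by (intro const_polys_over[OF A(1)] subring_set_power[OF A(1)])
    ultimately show ?thesis using gf rP unfolding J_def by blast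
  qed
  obtain u where u: "J u" "\<And>v. J v \<Longrightarrow> degree u \<le> degree v"
    using ex_has_least_nat[of J r degree, OF Jr] by blast
  have degr: "degree r < degree f" using gf(4) degf by auto
  have degu: "degree u < degree f" using u(2)[OF Jr] degr by linarith
  obtain q0 where q0: "u \<in> polys_over A" "poly u b \<notin> P" "q0 \<in> polys_over A"
    "poly u b - poly q0 b * s \<in> P" using u(1) unfolding J_def by blast
  have u0: "u \<noteq> 0" using q0 P_0 by auto
  \<comment> \<open>Otherwise \<open>f\<close> is divided by \<open>u\<close>. A remainder with
    value outside \<open>P\<close> would be a smaller member of \<open>J\<close>. If its value is in
    \<open>P\<close>, then so is that of \<open>q1\<close>, and both \<open>q1\<close> and
    \<open>r1\<close> are relations of degree below that of \<open>f\<close>; their coefficients are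
    then in \<open>P\<close>, which puts \<open>d ^ k1 * c\<close> into \<open>P\<close>.\<close>
  have degu0: "degree u = 0"
  proof (rule ccontr)
    assume pos: "degree u \<noteq> 0"
    define d where "d = lead_coeff u"
    have dP: "d \<notin> P"
    proof
      assume d: "d \<in> P"
      define v where "v = u - monom (lead_coeff u) (degree u)"
      have v: "v \<in> polys_over A" "degree v < degree u" "poly u b - poly v b \<in> P"
        unfolding v_def using lower[OF q0(1)] pos d by (auto simp: d_def)
      have "poly v b \<notin> P"
        using v(3) q0(2) P_add[of "poly u b - poly v b" "poly v b"] by auto
      moreover have "poly v b - poly q0 b * s = poly u b - poly q0 b * s - (poly u b - poly v b)"
        by simp
      then have "poly v b - poly q0 b * s \<in> P" using P_diff[OF q0(4) v(3)] by metis
      ultimately have "J v" using v q0 by (auto simp: J_def)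
      then show False using u(2) v(2) by fastforce
    qed
    have dU: "d \<in> A" "d \<in> U" unfolding d_def using q0 coeff_polys_over cU by auto
    obtain k1 q1 r1 where d1: "q1 \<in> polys_over A" "r1 \<in> polys_over A"
      "smult (d ^ k1) f = q1 * u + r1" "r1 = 0 \<or> degree r1 < degree u"
      "degree q1 \<le> degree f - degree u"
      using pseudo_division_over[OF A(1) q0(1) u0 fA(1)] unfolding d_def by metis
    have e1: "d ^ k1 * poly f b = poly q1 b * poly u b + poly r1 b"
      using arg_cong[OF d1(3), of "\<lambda>p. poly p b"] by simp
    have r1P: "poly r1 b \<in> P"
    proof (rule ccontr)
      assume nP: "poly r1 b \<notin> P"
      have "poly r1 b - poly (- (q1 * q0)) b * s
        = d ^ k1 * poly f b - poly q1 b * (poly u b - poly q0 b * s)"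
        using e1 by (simp add: algebra_simps)
      also have "\<dots> \<in> P" by (rule P_diff[OF P_mult[OF fA(2)] P_mult[OF q0(4)]])
      finally have rel: "poly r1 b - poly (- (q1 * q0)) b * s \<in> P" .
      have "J r1" unfolding J_def using d1(1,2) q0(3) nP rel
        by (intro conjI bexI[of _ "- (q1 * q0)"] S)
      then show False using u(2)[of r1] d1(4) nP P_0 by auto
    qed
    have "poly q1 b * poly u b = d ^ k1 * poly f b - poly r1 b" using e1 by simp
    then have "poly q1 b * poly u b \<in> P" using fA r1P P_diff P_mult by metis
    then have "poly q1 b \<in> P" using P_prime q0 pU d1 by blast
    then have "coeff q1 i \<in> P" if "degree q1 < degree f" for i
      using small[OF d1(1)] that by blast
    moreover have "degree q1 < degree f" using d1(5) pos degf by linarith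
    ultimately have q1P: "coeff q1 i \<in> P" for i by blast
    have r1P': "coeff r1 i \<in> P" for i
      using small[OF d1(2) r1P] d1(4) degu by auto
    have "coeff (q1 * u + r1) (degree f) \<in> P"
      unfolding coeff_add coeff_mult using q1P r1P' by (auto intro!: P_add P_sum P_mult')
    then have "d ^ k1 * c \<in> P" unfolding d1(3)[symmetric] by (simp add: c_def)
    then show False using P_prime[of "d ^ k1" c] P_power[of d k1] dU dP c cP by (auto intro: SU)
  qed
  define t where "t = coeff u 0"
  have ut: "u = [:t:]" using degu0 unfolding t_def by (metis degree_0_id)
  have "poly u b = t" using ut by simp
  then have tA: "t \<in> A" "t \<notin> P" "t - poly q0 b * s \<in> P"
    using q0(2,4) coeff_polys_over[OF q0(1)] unfolding t_def by auto
  show ?thesis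
  proof (intro bexI[of _ "t * c"] allI impI)
    show "t * c \<in> A - P" using tA c cP P_prime[of t c] A by (auto intro: subring_set_mult)
    fix h :: "'a \<Rightarrow> 'k"
    assume h: "ring_hom_on A h \<and> (\<forall>x\<in>A \<inter> P. h x = 0) \<and> h (t * c) \<noteq> 0"
    then have hh: "ring_hom_on A h" by blast
    note H = map_poly_ring_hom_on[OF A(1) hh]
    have ht: "h t \<noteq> 0" "h c \<noteq> 0" using h ring_hom_on_mult[OF hh] tA c by auto
    have deg: "degree (map_poly h f) > 0"
    proof -
      have "coeff (map_poly h f) (degree f) \<noteq> 0"
        using ht by (simp add: coeff_map_poly ring_hom_on_0[OF A(1) hh] c_def)
      then show ?thesis using le_degree degf by fastforce
    qed
    then obtain \<beta> where \<beta>: "poly (map_poly h f) \<beta> = 0" using alg_closed_imp_poly_has_root by blast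
    \<comment> \<open>Division by \<open>f\<close> leaves a relation of smaller degree, whose
      coefficients lie in \<open>P\<close> and are killed by \<open>h\<close>; the factor
      \<open>h c ^ k\<close> is nonzero and cancels.\<close>
    have root: "poly (map_poly h w) \<beta> = 0" if w: "w \<in> polys_over A" "poly w b \<in> P" for w
    proof -
      obtain k q r where kk: "q \<in> polys_over A" "r \<in> polys_over A" "smult (c ^ k) w = q * f + r"
        "r = 0 \<or> degree r < degree f"
        using pseudo_division_over[OF A(1) fA(1) f0 w(1)] unfolding c_def by metis
      have "poly r b = c ^ k * poly w b - poly q b * poly f b"
        using arg_cong[OF kk(3), of "\<lambda>p. poly p b"] by simp
      then have "poly r b \<in> P" using w fA by (auto intro: P_diff P_mult)
      then have "map_poly h r = 0"
        using small[OF kk(2)] kk(2,4) h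
        by (intro poly_eqI) (auto simp: coeff_map_poly ring_hom_on_0[OF A(1) hh] coeff_polys_over)
      moreover have "map_poly h (smult (c ^ k) w) = map_poly h q * map_poly h f + map_poly h r"
        unfolding kk(3) using kk fA by (simp add: ring_hom_on_add[OF H] ring_hom_on_mult[OF H] S)
      moreover have "map_poly h (smult (c ^ k) w) = smult (h c ^ k) (map_poly h w)"
        using w c subring_set_power[OF A(1) c(1)]
        by (intro poly_eqI) (simp add: coeff_map_poly ring_hom_on_0[OF A(1) hh] coeff_polys_over
            ring_hom_on_mult[OF hh] ring_hom_on_power[OF A(1) hh])
      ultimately have "smult (h c ^ k) (map_poly h w) = map_poly h q * map_poly h f" by simp
      then have "h c ^ k * poly (map_poly h w) \<beta> = 0"
        using \<beta> by (metis mult_zero_right poly_mult poly_smult)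
      then show ?thesis using ht by simp
    qed
    from induced_hom[OF A(1) hh root] obtain h' where h': "ring_hom_on (adjoin A b) h'"
      "\<And>x. x \<in> adjoin A b \<Longrightarrow> x \<in> P \<Longrightarrow> h' x = 0"
      "\<And>f. f \<in> polys_over A \<Longrightarrow> h' (poly f b) = poly (map_poly h f) \<beta>"
      by blast
    note SA = subring_set_adjoin[OF A(1), of b]
    have q0s: "poly q0 b \<in> adjoin A b" "t \<in> adjoin A b"
      using q0 subset_adjoin[OF A(1)] tA by (auto simp: adjoin_def)
    have "h' (t - poly q0 b * s) = 0"
      using tA s q0s by (intro h' subring_set_intros[OF SA])
    then have "h' t = h' (poly q0 b) * h' s"
      using q0s s by (simp add: ring_hom_on_diff[OF SA h'(1)] ring_hom_on_mult[OF h'(1)] subring_set_mult[OF SA])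
    moreover have "h' t = h t"
      using h'(3)[OF const_polys_over[OF A(1) tA(1)]] by (simp add: map_poly_pCons ring_hom_on_0[OF A(1) hh])
    ultimately have "h' s \<noteq> 0" using ht by auto
    then show "\<exists>h' :: 'a \<Rightarrow> 'k. ring_hom_on (adjoin A b) h' \<and> (\<forall>x\<in>adjoin A b \<inter> P. h' x = 0) \<and> h' s \<noteq> 0"
      using h' by blast
  qed
qed

text \<open>Generators are added one at a time. Extending a map across \<open>b\<close> without
  killing \<open>s\<close> costs a condition on an element \<open>t\<close> of the smaller ring,
  hence the induction over arbitrary \<open>s\<close>. The base ring consists of integers, of which
  only 0 lies in \<open>P\<close>.\<close>

theorem finitely_generated_hom:
  assumes "finite T" "T \<subseteq> U" "s \<in> subring_set hull T" "s \<notin> P"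
    and char0: "\<And>n. of_int n \<in> P \<Longrightarrow> n = 0"
  shows "\<exists>h :: 'a \<Rightarrow> 'k::{alg_closed_field, field_char_0}. ring_hom_on (subring_set hull T) h \<and>
    (\<forall>x\<in>(subring_set hull T) \<inter> P. h x = 0) \<and> h s \<noteq> 0"
  using assms(1-4)
proof (induction T arbitrary: s rule: finite_induct)
  case empty
  have sub: "subring_set hull {} \<subseteq> range (of_int :: int \<Rightarrow> 'a)"
  proof (rule hull_minimal)
    show "subring_set (range (of_int :: int \<Rightarrow> 'a))"
      unfolding subring_set_def
      by (metis (no_types, lifting) imageE of_int_1 of_int_diff of_int_mult rangeI)
  qed simp
  have inj: "m = n" if "of_int m = (of_int n :: 'a)" for m n
    using char0[of "m - n"] that P_0 by simp
  \<comment> \<open>By \<open>inj\<close> an element is the image of at most one integer, so the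
    description is unambiguous.\<close>
  define h where "h x = (of_int (THE n. x = of_int n) :: 'k)" for x :: 'a
  have h: "h (of_int n) = of_int n" for n
    unfolding h_def by (subst the_equality[of _ n]) (auto dest: inj)
  have "ring_hom_on (range of_int) h"
    unfolding ring_hom_on_def
  proof (intro conjI ballI)
    show "h 1 = 1" using h[of 1] by simp
    fix x y assume "x \<in> range (of_int :: int \<Rightarrow> 'a)" "y \<in> range (of_int :: int \<Rightarrow> 'a)"
    then obtain a b where "x = of_int a" "y = of_int b" by blast
    then show "h (x + y) = h x + h y" "h (x * y) = h x * h y"
      using h[of "a + b"] h[of "a * b"] by (auto simp: h)
  qed
  then have "ring_hom_on (subring_set hull {}) h"
    using sub unfolding ring_hom_on_def by blast
  moreover have "h x = 0" if "x \<in> subring_set hull {}" "x \<in> P" for x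
    using that sub char0 h by (metis imageE of_int_0 subset_eq)
  moreover have "h s \<noteq> 0"
    using empty(2,3) sub h P_0 by (metis imageE of_int_0 of_int_eq_0_iff subset_eq)
  ultimately show ?case by blast
next
  case (insert b T)
  define A where "A = subring_set hull T"
  have A: "subring_set A" "T \<subseteq> A"
    unfolding A_def using subring_set_hull hull_subset[of T subring_set] by auto
  have AU: "A \<subseteq> U" unfolding A_def using insert.prems subring_U by (intro hull_minimal) auto
  have bU: "b \<in> U" using insert.prems by auto
  have sub: "subring_set hull (insert b T) \<subseteq> adjoin A b"
    using subring_set_adjoin[OF A(1)] subset_adjoin[OF A(1)] A by (intro hull_minimal) auto
  have s: "s \<in> adjoin A b" "s \<notin> P" using insert.prems sub by auto
  have "\<exists>t\<in>A - P. \<forall>h :: 'a \<Rightarrow> 'k.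
    ring_hom_on A h \<and> (\<forall>x\<in>A \<inter> P. h x = 0) \<and> h t \<noteq> 0 \<longrightarrow>
    (\<exists>h' :: 'a \<Rightarrow> 'k. ring_hom_on (adjoin A b) h' \<and> (\<forall>x\<in>adjoin A b \<inter> P. h' x = 0) \<and> h' s \<noteq> 0)"
  proof (cases "\<forall>f\<in>polys_over A. poly f b \<in> P \<longrightarrow> (\<forall>i. coeff f i \<in> P)")
    case True
    then show ?thesis using hom_extension_transcendental[OF A(1) _ s, where 'k = 'k] by blast
  next
    case False
    then show ?thesis using hom_extension_algebraic[OF A(1) AU bU _ _ _ s, where 'k = 'k] by blast
  qed
  then obtain t where t: "t \<in> A" "t \<notin> P" and ext: "\<And>h :: 'a \<Rightarrow> 'k.
    ring_hom_on A h \<Longrightarrow> (\<forall>x\<in>A \<inter> P. h x = 0) \<Longrightarrow> h t \<noteq> 0 \<Longrightarrow>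
    (\<exists>h' :: 'a \<Rightarrow> 'k. ring_hom_on (adjoin A b) h' \<and> (\<forall>x\<in>adjoin A b \<inter> P. h' x = 0) \<and> h' s \<noteq> 0)"
    by blast
  obtain h :: "'a \<Rightarrow> 'k" where "ring_hom_on A h" "\<forall>x\<in>A \<inter> P. h x = 0" "h t \<noteq> 0"
    using insert.IH[of t] t insert.prems unfolding A_def by auto
  from ext[OF this] obtain h' :: "'a \<Rightarrow> 'k" where
    "ring_hom_on (adjoin A b) h'" "\<forall>x\<in>adjoin A b \<inter> P. h' x = 0" "h' s \<noteq> 0" by blast
  then show ?case using sub unfolding ring_hom_on_def by (intro exI[of _ h']) blast
qed

end

section \<open>Hensel lifting and primitive elements\<close>

text \<open>A variant of Euclid's argument. With \<open>c = poly f 0\<close>, the value of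
  \<open>f\<close> at \<open>c * M * t\<close> is \<open>c\<close> times a number \<open>v\<close>
  congruent to 1 modulo \<open>M\<close>, and no prime factor of \<open>v\<close> divides
  \<open>M\<close>. The role of \<open>M\<close> is that of a common denominator.\<close>

lemma prime_dividing_value:
  fixes f :: "int poly" and M :: int
  assumes deg: "degree f > 0" and M: "M \<noteq> 0"
  obtains p :: nat and r :: int where "prime p" "\<not> int p dvd M" "int p dvd poly f r"
proof -
  define c where "c = poly f 0"
  \<comment> \<open>\<open>f'\<close> is the quotient of \<open>f - c\<close> by the variable, not a
    derivative.\<close>
  obtain f' where f': "f = pCons c f'"
    unfolding c_def by (cases f) auto
  show thesis
  proof (cases "c = 0")
    case True
    obtain p :: nat where p: "prime p" "p > nat \<bar>M\<bar>" using bigger_prime by blast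
    have "\<not> int p dvd M" using p M dvd_imp_le_int[of M "int p"] by auto
    then show thesis using p True that[of p 0] by (simp add: c_def)
  next
    case False
    define g where "g = pcompose f [:0, c * M:]"
    have g: "poly g t = c * (1 + M * t * poly f' (c * M * t))" for t
      by (simp add: g_def poly_pcompose f' algebra_simps)
    have degg: "degree g > 0" using deg False M by (simp add: g_def degree_pcompose)
    have fin: "finite {t. poly g t = a}" for a
    proof -
      have "g - [:a:] \<noteq> 0" using degg by auto
      from poly_roots_finite[OF this] show ?thesis by simp
    qed
    \<comment> \<open>These values of \<open>g\<close> correspond to \<open>v\<close> being 1, -1 or
      0; all others leave \<open>v\<close> a nonzero non-unit.\<close>
    have "finite ({t. poly g t = c} \<union> {t. poly g t = - c} \<union> {t. poly g t = 0})"
      using fin by blast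
    from ex_new_if_finite[OF infinite_UNIV_int this]
    obtain t where t: "poly g t \<noteq> c" "poly g t \<noteq> - c" "poly g t \<noteq> 0" by auto
    define v where "v = 1 + M * t * poly f' (c * M * t)"
    have v: "v \<noteq> 1" "v \<noteq> - 1" "v \<noteq> 0" using t unfolding g[of t] v_def[symmetric] by auto
    then have "\<bar>v\<bar> \<noteq> 1" by linarith
    then obtain q where q: "prime q" "q dvd v"
      using prime_divisor_exists[of v] v by auto
    then obtain p where p: "q = int p" "prime p"
      using prime_int_nat_transfer by (metis int_nat_eq prime_ge_0_int)
    have "\<not> int p dvd M"
    proof
      assume "int p dvd M"
      then have "int p dvd v - M * t * poly f' (c * M * t)" using q p by auto
      then show False using q p by (auto simp: v_def)
    qed
    moreover have "int p dvd poly f (c * M * t)"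
    proof -
      have "poly f (c * M * t) = c * v" using g[of t] by (simp add: g_def poly_pcompose v_def mult.commute)
      then show ?thesis using q p by simp
    qed
    ultimately show thesis using p that by blast
  qed
qed

lemma poly_taylor1:
  fixes f :: "'a::idom poly"
  shows "\<exists>q. poly f (x + h) = poly f x + h * poly (pderiv f) x + h\<^sup>2 * q"
proof (induction f)
  case 0
  then show ?case by (intro exI[of _ 0]) simp
next
  case (pCons a f)
  then obtain q where q: "poly f (x + h) = poly f x + h * poly (pderiv f) x + h\<^sup>2 * q" by blast
  show ?case
    by (intro exI[of _ "poly (pderiv f) x + x * q + h * q"])
       (simp only: poly_pCons pderiv_pCons q poly_add, simp add: algebra_simps power2_eq_square)
qed

text \<open>The root is delivered as integer approximations, entry \<open>n\<close> being a root
  modulo \<open>p ^ (n + 1)\<close>, which is the indexing of \<open>padic_integers\<close>. The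
  invariant \<open>Q\<close> includes that the derivative stays nonzero modulo
  \<open>p\<close>.\<close>

lemma hensel:
  fixes f :: "int poly" and p :: nat
  assumes p: "prime p" and r: "int p dvd poly f r" "\<not> int p dvd poly (pderiv f) r"
  obtains x where "x 0 = r" "\<And>n. int p ^ Suc n dvd poly f (x n)"
    "\<And>n. int p ^ Suc n dvd x (Suc n) - x n"
proof -
  define Q where "Q n x \<longleftrightarrow> int p ^ Suc n dvd poly f x \<and> \<not> int p dvd poly (pderiv f) x \<and> (n = 0 \<longrightarrow> x = r)"
    for n x
  have "\<exists>x. \<forall>n. Q n (x n) \<and> int p ^ Suc n dvd x (Suc n) - x n"
  proof (rule dependent_nat_choice)
    show "\<exists>x. Q 0 x" using r by (auto simp: Q_def)
    fix x n assume Q: "Q n x"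
    have "coprime (int p) (poly (pderiv f) x)"
      using Q p by (intro prime_imp_coprime) (auto simp: Q_def)
    then have "coprime (poly (pderiv f) x) (int p)" by (simp add: coprime_commute)
    then obtain w where "[poly (pderiv f) x * w = 1] (mod int p)"
      using cong_solve_coprime_int by blast
    then have w: "int p dvd 1 - w * poly (pderiv f) x"
      by (metis cong_iff_dvd_diff cong_sym mult.commute)
    \<comment> \<open>A Newton step in which \<open>w\<close> inverts the derivative only modulo
      \<open>p\<close>. This is enough: \<open>1 - w * poly (pderiv f) x\<close> supplies the one
      additional factor \<open>p\<close>.\<close>
    define h where "h = - (poly f x * w)"
    have pf: "int p ^ Suc n dvd poly f x" using Q by (simp add: Q_def)
    have ph: "int p ^ Suc n dvd h" using pf by (simp add: h_def)
    then have ph1: "int p dvd h" by (meson dvd_power_le dvd_trans dvd_power zero_less_Suc)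
    obtain q where q: "poly f (x + h) = poly f x + h * poly (pderiv f) x + h\<^sup>2 * q"
      using poly_taylor1 by blast
    obtain q' where q': "poly (pderiv f) (x + h) =
        poly (pderiv f) x + h * poly (pderiv (pderiv f)) x + h\<^sup>2 * q'"
      using poly_taylor1 by blast
    have "int p ^ Suc n * int p dvd poly f x * (1 - w * poly (pderiv f) x)"
      by (rule mult_dvd_mono[OF pf w])
    moreover have "int p ^ Suc n * int p dvd h * h"
      by (rule mult_dvd_mono[OF ph ph1])
    then have "int p ^ Suc n * int p dvd h\<^sup>2 * q" by (simp add: power2_eq_square del: power_Suc)
    moreover have "poly f (x + h) = poly f x * (1 - w * poly (pderiv f) x) + h\<^sup>2 * q"
    proof -
      have "poly f x + h * poly (pderiv f) x = poly f x * (1 - w * poly (pderiv f) x)"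
        by (simp add: h_def algebra_simps)
      then show ?thesis unfolding q by simp
    qed
    ultimately have "int p ^ Suc (Suc n) dvd poly f (x + h)"
      by (metis dvd_add power_Suc2)
    moreover have "\<not> int p dvd poly (pderiv f) (x + h)"
    proof
      assume "int p dvd poly (pderiv f) (x + h)"
      moreover have "int p dvd h * poly (pderiv (pderiv f)) x + h\<^sup>2 * q'"
        using ph1 by (simp add: power2_eq_square)
      ultimately have "int p dvd poly (pderiv f) x"
        unfolding q' by (metis add.assoc dvd_add_left_iff)
      then show False using Q by (simp add: Q_def)
    qed
    ultimately show "\<exists>y. Q (Suc n) y \<and> int p ^ Suc n dvd y - x"
      using ph by (intro exI[of _ "x + h"]) (auto simp: Q_def simp del: power_Suc)
  qed
  then show thesis using that unfolding Q_def by blast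
qed

section \<open>Algebraic numbers, minimal polynomials and simple extensions\<close>

type_synonym qbar = "rat alg_closure"

definition rpoly :: "rat poly \<Rightarrow> qbar \<Rightarrow> qbar" where
  "rpoly g \<theta> = poly (map_poly to_ac g) \<theta>"

lemma map_poly_to_ac_hom: "ring_hom_on UNIV (map_poly (to_ac :: rat \<Rightarrow> qbar))"
proof -
  have "subring_set (UNIV :: rat set)" "ring_hom_on UNIV (to_ac :: rat \<Rightarrow> qbar)"
    by (auto simp: subring_set_def ring_hom_on_def)
  from map_poly_ring_hom_on[OF this] show ?thesis by (simp add: polys_over_def)
qed

lemma subring_set_UNIV: "subring_set UNIV"
  by (simp add: subring_set_def)

lemma rpoly_ring_hom: "ring_hom_on UNIV (\<lambda>g. rpoly g \<theta>)"
  using map_poly_to_ac_hom unfolding ring_hom_on_def rpoly_def by simp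

lemma rpoly_simps [simp]:
  "rpoly 0 \<theta> = 0" "rpoly 1 \<theta> = 1" "rpoly (f + g) \<theta> = rpoly f \<theta> + rpoly g \<theta>"
  "rpoly (f * g) \<theta> = rpoly f \<theta> * rpoly g \<theta>" "rpoly (f - g) \<theta> = rpoly f \<theta> - rpoly g \<theta>"
  "rpoly [:c:] \<theta> = to_ac c"
  using ring_hom_on_0[OF subring_set_UNIV rpoly_ring_hom] ring_hom_on_1[OF rpoly_ring_hom]
    ring_hom_on_add[OF rpoly_ring_hom] ring_hom_on_mult[OF rpoly_ring_hom]
    ring_hom_on_diff[OF subring_set_UNIV rpoly_ring_hom]
  by (auto simp: rpoly_def map_poly_pCons)

text \<open>Irreducibility is recorded as a Bezout identity. It yields inverses in
  \<open>qadj \<theta>\<close>, and it can later be evaluated modulo a prime, where it certifies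
  that a value is not divisible by that prime.\<close>

lemma minimal_poly:
  fixes \<theta> :: qbar
  obtains f where "rpoly f \<theta> = 0" "degree f > 0" "lead_coeff f = 1"
    "\<And>g. rpoly g \<theta> = 0 \<Longrightarrow> f dvd g" "\<And>g. rpoly g \<theta> \<noteq> 0 \<Longrightarrow> \<exists>u v. u * f + v * g = 1"
proof -
  define Z where "Z f \<longleftrightarrow> f \<noteq> 0 \<and> rpoly f \<theta> = 0" for f
  obtain f0 where "Z f0" unfolding Z_def rpoly_def using alg_closure_algebraic by metis
  then obtain f1 where f1: "Z f1" "\<And>g. Z g \<Longrightarrow> degree f1 \<le> degree g"
    using ex_has_least_nat[of Z f0 degree] by blast
  define f where "f = smult (inverse (lead_coeff f1)) f1"
  have "f = [:inverse (lead_coeff f1):] * f1" by (simp add: f_def)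
  then have "rpoly f \<theta> = 0" using f1(1) by (simp only: rpoly_simps) (simp add: Z_def)
  moreover have f1n: "f1 \<noteq> 0" using f1 by (simp add: Z_def)
  ultimately have f: "Z f" "\<And>g. Z g \<Longrightarrow> degree f \<le> degree g" "lead_coeff f = 1" "f \<noteq> 0"
    using f1 by (auto simp: f_def Z_def)
  have dv: "f dvd g" if "rpoly g \<theta> = 0" for g
  proof -
    have "rpoly (g - g div f * f) \<theta> = 0" using that f(1) by (simp add: Z_def)
    then have "rpoly (g mod f) \<theta> = 0" by (simp add: minus_div_mult_eq_mod)
    then have "g mod f = 0" using f(2)[of "g mod f"] degree_mod_less[OF f(4), of g]
      unfolding Z_def by fastforce
    then show ?thesis by (rule mod_0_imp_dvd)
  qed
  have bez: "\<exists>u v. u * f + v * g = 1" if "rpoly g \<theta> \<noteq> 0" for g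
  proof -
    \<comment> \<open>\<open>\<theta>\<close> is no root of \<open>d\<close>, hence one of the
      cofactor \<open>e\<close>; minimality of the degree of \<open>f\<close> then makes
      \<open>d\<close> a unit.\<close>
    define d where "d = gcd f g"
    obtain e where e: "f = d * e" unfolding d_def by (metis dvdE gcd_dvd1)
    obtain e' where e': "g = d * e'" unfolding d_def by (metis dvdE gcd_dvd2)
    have "rpoly d \<theta> \<noteq> 0" using that e' by auto
    moreover have "rpoly d \<theta> * rpoly e \<theta> = 0" using f(1) e unfolding Z_def by (metis rpoly_simps(4))
    ultimately have "Z e" using e f(4) by (auto simp: Z_def)
    then have "degree f \<le> degree e" using f by blast
    moreover have "degree f = degree d + degree e" using e f(4) degree_mult_eq by auto
    ultimately have "degree d = 0" by linarith
    then have "is_unit d" using f(4) e is_unit_iff_degree by fastforce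
    then have "d = 1" unfolding d_def using is_unit_gcd_iff by blast
    then show ?thesis unfolding d_def by (metis bezout_coefficients_fst_snd)
  qed
  have "degree f > 0"
  proof (rule ccontr)
    assume "\<not> degree f > 0"
    then have "f = 1" using f(3) by (metis degree_0_id gr0I one_pCons)
    then show False using f(1) by (simp add: Z_def)
  qed
  then show thesis using that f dv bez by (auto simp: Z_def)
qed

text \<open>In characteristic 0 the derivative is a nonzero polynomial of smaller degree, which
  \<open>f\<close> cannot divide.\<close>

lemma minimal_poly_separable:
  fixes \<theta> :: qbar
  assumes "degree f > 0" "\<And>g. rpoly g \<theta> = 0 \<Longrightarrow> f dvd g"
  shows "rpoly (pderiv f) \<theta> \<noteq> 0"
proof
  assume "rpoly (pderiv f) \<theta> = 0"
  then have "f dvd pderiv f" by (rule assms(2))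
  moreover have "pderiv f \<noteq> 0" using assms(1) pderiv_eq_0_iff[of f] by auto
  ultimately have "degree f \<le> degree (pderiv f)" by (rule dvd_imp_degree_le)
  then show False using assms(1) by (simp add: degree_pderiv)
qed

text \<open>The ring Q[\<theta>], which is the field Q(\<theta>) by
  \<open>inverse_qadj\<close>.\<close>

definition qadj :: "qbar \<Rightarrow> qbar set" where
  "qadj \<theta> = range (\<lambda>g. rpoly g \<theta>)"

lemma subring_qadj: "subring_set (qadj \<theta>)"
  unfolding subring_set_def qadj_def
proof (intro conjI ballI)
  show "1 \<in> range (\<lambda>g. rpoly g \<theta>)" by (rule range_eqI[of _ _ 1]) simp
  fix x y assume "x \<in> range (\<lambda>g. rpoly g \<theta>)" "y \<in> range (\<lambda>g. rpoly g \<theta>)"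
  then obtain f g where "x = rpoly f \<theta>" "y = rpoly g \<theta>" by blast
  then show "x - y \<in> range (\<lambda>g. rpoly g \<theta>)" "x * y \<in> range (\<lambda>g. rpoly g \<theta>)"
    by (metis rangeI rpoly_simps(5), metis rangeI rpoly_simps(4))
qed

lemma to_ac_qadj: "to_ac c \<in> qadj \<theta>"
  unfolding qadj_def by (rule range_eqI[of _ _ "[:c:]"]) simp

lemma generator_qadj: "\<theta> \<in> qadj \<theta>"
  unfolding qadj_def by (rule range_eqI[of _ _ "[:0, 1:]"]) (simp add: rpoly_def map_poly_pCons)

lemma inverse_qadj:
  assumes "x \<in> qadj \<theta>" shows "inverse x \<in> qadj \<theta>"
proof (cases "x = 0")
  case True
  then show ?thesis using assms by simp
next
  case False
  obtain g where g: "x = rpoly g \<theta>" using assms by (auto simp: qadj_def)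
  obtain f where f: "rpoly f \<theta> = 0" "\<And>g. rpoly g \<theta> \<noteq> 0 \<Longrightarrow> \<exists>u v. u * f + v * g = 1"
    using minimal_poly by metis
  obtain u v where "u * f + v * g = 1" using f(2)[of g] False g by blast
  then have "rpoly (u * f + v * g) \<theta> = 1" by simp
  then have "rpoly v \<theta> * x = 1" using f(1) g by simp
  then have "inverse x = rpoly v \<theta>" using False by (metis inverse_unique mult.commute)
  then show ?thesis by (simp add: qadj_def)
qed

lemma qadj_subset:
  assumes "\<theta> \<in> qadj \<eta>" shows "qadj \<theta> \<subseteq> qadj \<eta>"
proof
  fix x assume "x \<in> qadj \<theta>"
  then obtain g where "x = poly (map_poly to_ac g) \<theta>" by (auto simp: qadj_def rpoly_def)
  moreover have "map_poly to_ac g \<in> polys_over (qadj \<eta>)"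
    by (simp add: polys_over_def coeff_map_poly to_ac_qadj)
  ultimately show "x \<in> qadj \<eta>"
    using poly_polys_over[OF subring_qadj subring_qadj order_refl assms] by blast
qed

lemma pcompose_polys_over:
  assumes A: "subring_set A" and q: "q \<in> polys_over A"
  shows "f \<in> polys_over A \<Longrightarrow> pcompose f q \<in> polys_over A"
proof (induction f)
  case 0
  then show ?case by simp
next
  case (pCons a f)
  note S = subring_set_intros[OF subring_set_polys_over[OF A]]
  have "a \<in> A" using coeff_polys_over[OF pCons.prems, of 0] by simp
  moreover have "f \<in> polys_over A"
    unfolding polys_over_def using coeff_polys_over[OF pCons.prems, of "Suc _"] by simp
  ultimately show ?case
    using pCons.IH q const_polys_over[OF A] by (auto simp: pcompose_pCons intro!: S)
qed

text \<open>The minimal polynomial of \<open>b\<close> over the field generated by \<open>\<theta> = a + c b\<close> divides both the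
  minimal polynomial of \<open>b\<close> over the rationals and that of \<open>a\<close> evaluated at \<open>\<theta> - c x\<close>.
  For a suitable \<open>c\<close> their only common root is \<open>b\<close>, and it is simple.\<close>

lemma primitive_element_pair:
  fixes a b :: qbar
  obtains \<theta> where "a \<in> qadj \<theta>" "b \<in> qadj \<theta>"
proof -
  obtain fa where fa: "rpoly fa a = 0" "degree fa > 0"
    using minimal_poly by metis
  obtain fb where fb: "rpoly fb b = 0" "degree fb > 0" "\<And>g. rpoly g b = 0 \<Longrightarrow> fb dvd g"
    using minimal_poly by metis
  define ga where "ga = map_poly to_ac fa"
  define gb where "gb = map_poly to_ac fb"
  have nz: "ga \<noteq> 0" "gb \<noteq> 0"
    using fa fb unfolding ga_def gb_def by (subst map_poly_eq_0_iff; auto)+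
  have roots: "poly ga a = 0" "poly gb b = 0" using fa fb by (auto simp: ga_def gb_def rpoly_def)
  have "pderiv gb = map_poly to_ac (pderiv fb)"
    by (rule poly_eqI) (simp add: gb_def coeff_pderiv coeff_map_poly)
  then have simple: "poly (pderiv gb) b \<noteq> 0"
    using minimal_poly_separable[OF fb(2,3)] by (simp add: rpoly_def)
  \<comment> \<open>Contains every \<open>c\<close> for which \<open>\<theta> - c * \<beta>\<close>
    is a root of \<open>ga\<close> for some root \<open>\<beta>\<close> of \<open>gb\<close> other
    than \<open>b\<close>. For \<open>\<beta> = b\<close> the division by zero merely puts 0 into
    this finite set.\<close>
  define bad where "bad = (\<lambda>(\<alpha>, \<beta>). (\<alpha> - a) / (b - \<beta>)) ` ({x. poly ga x = 0} \<times> {x. poly gb x = 0})"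
  have "finite bad" unfolding bad_def using nz poly_roots_finite by blast
  moreover have "infinite (range (of_nat :: nat \<Rightarrow> qbar))"
    by (simp add: finite_image_iff inj_of_nat)
  ultimately obtain n :: nat where "of_nat n \<notin> bad" by (metis finite_subset image_subsetI)
  define c :: qbar where "c = of_nat n"
  have c: "c \<notin> bad" using \<open>of_nat n \<notin> bad\<close> by (simp add: c_def)
  define \<theta> where "\<theta> = a + c * b"
  define k where "k = qadj \<theta>"
  have k: "subring_set k" unfolding k_def by (rule subring_qadj)
  have ck: "c \<in> k" unfolding c_def by (rule subring_set_of_nat[OF k])
  have \<theta>k: "\<theta> \<in> k" unfolding k_def by (rule generator_qadj)
  define F where "F = pcompose ga [:\<theta>, - c:]"
  have gak: "ga \<in> polys_over k" "gb \<in> polys_over k"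
    by (auto simp: polys_over_def ga_def gb_def coeff_map_poly k_def to_ac_qadj)
  have "[:\<theta>, - c:] \<in> polys_over k"
    using \<theta>k ck k by (auto simp: polys_over_def coeff_pCons split: nat.split intro: subring_set_intros)
  then have Fk: "F \<in> polys_over k" unfolding F_def using pcompose_polys_over[OF k] gak by blast
  have Froot: "poly F b = 0" by (simp add: F_def poly_pcompose \<theta>_def roots)
  have common: "\<beta> = b" if "poly gb \<beta> = 0" "poly F \<beta> = 0" for \<beta>
  proof (rule ccontr)
    assume ne: "\<beta> \<noteq> b"
    define \<alpha> where "\<alpha> = \<theta> - c * \<beta>"
    have "poly ga \<alpha> = 0" using that(2) by (simp add: F_def poly_pcompose \<alpha>_def algebra_simps)
    moreover have "c = (\<alpha> - a) / (b - \<beta>)" using ne by (simp add: \<alpha>_def \<theta>_def field_simps)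
    ultimately have "c \<in> bad" using that(1) unfolding bad_def by force
    then show False using c by simp
  qed
  \<comment> \<open>A \<open>d\<close> of least degree is, up to a constant factor, the minimal
    polynomial of \<open>b\<close> over the field \<open>k\<close>.\<close>
  define Z where "Z d \<longleftrightarrow> d \<in> polys_over k \<and> d \<noteq> 0 \<and> poly d b = 0" for d
  have "Z gb" using gak nz roots by (simp add: Z_def)
  then obtain d where d: "Z d" "\<And>e. Z e \<Longrightarrow> degree d \<le> degree e"
    using ex_has_least_nat[of Z gb degree] by blast
  have d': "d \<in> polys_over k" "d \<noteq> 0" "poly d b = 0" using d by (auto simp: Z_def)
  have ddvd: "d dvd e" if e: "e \<in> polys_over k" "poly e b = 0" for e
  proof -
    obtain j q r where qr: "q \<in> polys_over k" "r \<in> polys_over k"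
      "smult (lead_coeff d ^ j) e = q * d + r" "r = 0 \<or> degree r < degree d"
      using pseudo_division_over[OF k d'(1,2) e(1)] by metis
    have "poly r b = 0" using arg_cong[OF qr(3), of "\<lambda>p. poly p b"] e d' by simp
    then have "r = 0" using d(2)[of r] qr by (fastforce simp: Z_def)
    then have "d dvd smult (lead_coeff d ^ j) e" using qr by simp
    then show ?thesis using d' by (simp add: dvd_smult_iff)
  qed
  have root_d: "\<beta> = b" if "poly d \<beta> = 0" for \<beta>
  proof (rule common)
    show "poly gb \<beta> = 0" using ddvd[OF gak(2) roots(2)] that by (auto elim!: dvdE)
    show "poly F \<beta> = 0" using ddvd[OF Fk Froot] that by (auto elim!: dvdE)
  qed
  obtain d1 where d1: "d = [:- b, 1:] * d1" using d'(3) by (auto simp: poly_eq_0_iff_dvd elim: dvdE)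
  \<comment> \<open>A further root of \<open>d\<close> could only be \<open>b\<close> again, which
    would be a double root of \<open>gb\<close>, against \<open>simple\<close>.\<close>
  have "degree d1 = 0"
  proof (rule ccontr)
    assume "degree d1 \<noteq> 0"
    then obtain \<beta> where "poly d1 \<beta> = 0" using alg_closed_imp_poly_has_root[of d1] by auto
    then have "poly d1 b = 0" using root_d[of \<beta>] d1 by auto
    then obtain d2 where "d1 = [:- b, 1:] * d2" by (auto simp: poly_eq_0_iff_dvd elim: dvdE)
    moreover obtain e where "gb = d * e" using ddvd[OF gak(2) roots(2)] by (auto elim: dvdE)
    ultimately have "gb = [:- b, 1:] * ([:- b, 1:] * (d2 * e))" using d1 by (simp only: mult.assoc)
    moreover have "poly (pderiv (h * (h * w))) b = 0" if "poly h b = 0" for h w :: "qbar poly"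
      using that by (simp add: pderiv_mult)
    from this[of "[:- b, 1:]" "d2 * e"]
    have "poly (pderiv ([:- b, 1:] * ([:- b, 1:] * (d2 * e)))) b = 0" by (simp del: mult_pCons_left)
    ultimately have "poly (pderiv gb) b = 0" by (simp only:)
    then show False using simple by simp
  qed
  then obtain l where l: "d1 = [:l:]" by (metis degree_0_id)
  have l0: "l \<noteq> 0" using d'(2) d1 l by auto
  \<comment> \<open>Being linear with coefficients in \<open>k\<close>, \<open>d\<close> exhibits
    \<open>b\<close> as a quotient of elements of the field \<open>k\<close>.\<close>
  have "d = [:- (b * l), l:]" using d1 l by simp
  then have "coeff d 0 = - (b * l)" "coeff d 1 = l" by auto
  then have "- (b * l) \<in> k" "l \<in> k" using coeff_polys_over[OF d'(1)] by metis+
  then have "- (b * l) * inverse l \<in> k"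
    using inverse_qadj subring_set_mult[OF k] unfolding k_def by blast
  then have "- b \<in> k" using l0 by (simp add: mult.assoc)
  then have bk: "b \<in> k" using subring_set_uminus[OF k] by fastforce
  have "\<theta> - c * b \<in> k" using \<theta>k ck bk by (intro subring_set_intros[OF k])
  then have "a \<in> k" by (simp add: \<theta>_def)
  then show thesis using bk that unfolding k_def by blast
qed

lemma primitive_element:
  fixes T :: "qbar set"
  assumes "finite T"
  obtains \<theta> where "T \<subseteq> qadj \<theta>"
proof -
  have "\<exists>\<theta>. T \<subseteq> qadj \<theta>"
    using assms
  proof (induction T rule: finite_induct)
    case (insert a T)
    then obtain \<eta> where \<eta>: "T \<subseteq> qadj \<eta>" by blast
    obtain \<theta> where "\<eta> \<in> qadj \<theta>" "a \<in> qadj \<theta>" using primitive_element_pair by blast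
    then have "insert a T \<subseteq> qadj \<theta>" using \<eta> qadj_subset by blast
    then show ?case ..
  qed simp
  then show thesis using that by blast
qed

section \<open>From algebraic numbers to p-adic integers\<close>

text \<open>The type class counterpart of \<open>eval_poly\<close>: one formula serves for complex
  numbers, \<open>qbar\<close>, \<open>rat poly\<close>, \<open>rat\<close>, \<open>int\<close> and
  integer sequences, and commutes with the homomorphisms between them.\<close>

definition mpoly_val :: "int mpol \<Rightarrow> (nat \<Rightarrow> 'a::comm_ring_1) \<Rightarrow> 'a" where
  "mpoly_val P x = (\<Sum>\<mu>\<in>Poly_Mapping.keys P. of_int (Poly_Mapping.lookup P \<mu>) *
     (\<Prod>i\<in>Poly_Mapping.keys \<mu>. x i ^ Poly_Mapping.lookup \<mu> i))"

lemma polys_in_keys: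
  "P \<in> polys_in m \<Longrightarrow> \<mu> \<in> Poly_Mapping.keys P \<Longrightarrow> i \<in> Poly_Mapping.keys \<mu> \<Longrightarrow> i \<in> {1..m}"
  unfolding polys_in_def by blast

lemma mpoly_val_cong:
  assumes "P \<in> polys_in m" "\<And>i. i \<in> {1..m} \<Longrightarrow> x i = y i"
  shows "mpoly_val P x = mpoly_val P y"
  unfolding mpoly_val_def using assms polys_in_keys[OF assms(1)]
  by (intro sum.cong prod.cong arg_cong2[of _ _ _ _ "(*)"] refl) simp

lemma mpoly_val_closed:
  assumes "subring_set A" "P \<in> polys_in m" "\<And>i. i \<in> {1..m} \<Longrightarrow> x i \<in> A"
  shows "mpoly_val P x \<in> A"
  unfolding mpoly_val_def using assms(3) polys_in_keys[OF assms(2)]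
  by (intro subring_set_intros[OF assms(1)]) blast+

lemma mpoly_val_hom:
  assumes A: "subring_set A" and h: "ring_hom_on A h"
    and P: "P \<in> polys_in m" and x: "\<And>i. i \<in> {1..m} \<Longrightarrow> x i \<in> A"
  shows "h (mpoly_val P x) = mpoly_val P (\<lambda>i. h (x i))"
proof -
  note S = subring_set_intros[OF A]
  have x': "x i \<in> A" if "\<mu> \<in> Poly_Mapping.keys P" "i \<in> Poly_Mapping.keys \<mu>" for \<mu> i
    using x polys_in_keys[OF P that] .
  have pr: "(\<Prod>i\<in>Poly_Mapping.keys \<mu>. x i ^ Poly_Mapping.lookup \<mu> i) \<in> A"
    "h (\<Prod>i\<in>Poly_Mapping.keys \<mu>. x i ^ Poly_Mapping.lookup \<mu> i) =
       (\<Prod>i\<in>Poly_Mapping.keys \<mu>. h (x i) ^ Poly_Mapping.lookup \<mu> i)"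
    if "\<mu> \<in> Poly_Mapping.keys P" for \<mu>
  proof -
    show "(\<Prod>i\<in>Poly_Mapping.keys \<mu>. x i ^ Poly_Mapping.lookup \<mu> i) \<in> A"
      using x'[OF that] by (intro S) blast
    have "h (\<Prod>i\<in>Poly_Mapping.keys \<mu>. x i ^ Poly_Mapping.lookup \<mu> i) =
        (\<Prod>i\<in>Poly_Mapping.keys \<mu>. h (x i ^ Poly_Mapping.lookup \<mu> i))"
      using x'[OF that] by (intro ring_hom_on_prod[OF A h] S) blast
    then show "h (\<Prod>i\<in>Poly_Mapping.keys \<mu>. x i ^ Poly_Mapping.lookup \<mu> i) =
       (\<Prod>i\<in>Poly_Mapping.keys \<mu>. h (x i) ^ Poly_Mapping.lookup \<mu> i)"
      using x'[OF that] ring_hom_on_power[OF A h] by simp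
  qed
  have "h (mpoly_val P x) = (\<Sum>\<mu>\<in>Poly_Mapping.keys P. h (of_int (Poly_Mapping.lookup P \<mu>) *
     (\<Prod>i\<in>Poly_Mapping.keys \<mu>. x i ^ Poly_Mapping.lookup \<mu> i)))"
    unfolding mpoly_val_def using pr by (intro ring_hom_on_sum[OF A h] S(6) S(11)) blast
  also have "\<dots> = mpoly_val P (\<lambda>i. h (x i))"
    unfolding mpoly_val_def using pr S(11)
    by (intro sum.cong refl) (simp add: ring_hom_on_mult[OF h] ring_hom_on_of_int[OF A h])
  finally show ?thesis .
qed

lemma mpoly_val_of_int: "mpoly_val P (\<lambda>i. of_int (x i)) = of_int (mpoly_val P x)"
  by (simp add: mpoly_val_def)

text \<open>Stated for an ideal \<open>I\<close> of a subring \<open>A\<close>, so that it covers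
  both the multiples of \<open>p ^ n\<close> among the p-integral rationals and ordinary congruences
  of integers.\<close>

lemma mpoly_val_congruent:
  assumes A: "subring_set A"
    and I: "0 \<in> I" "\<And>u v. u \<in> I \<Longrightarrow> v \<in> I \<Longrightarrow> u + v \<in> I" "\<And>a u. a \<in> A \<Longrightarrow> u \<in> I \<Longrightarrow> a * u \<in> I"
    and P: "P \<in> polys_in m"
    and x: "\<And>i. i \<in> {1..m} \<Longrightarrow> x i \<in> A" "\<And>i. i \<in> {1..m} \<Longrightarrow> y i \<in> A"
    and d: "\<And>i. i \<in> {1..m} \<Longrightarrow> x i - y i \<in> I"
  shows "mpoly_val P x - mpoly_val P y \<in> I"
proof -
  note S = subring_set_intros[OF A]
  have mult: "a * b - a' * b' \<in> I"
    if "a \<in> A" "b' \<in> A" "a - a' \<in> I" "b - b' \<in> I" for a b a' b'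
  proof -
    have "a * b - a' * b' = a * (b - b') + b' * (a - a')" by (simp add: algebra_simps)
    then show ?thesis using that I by simp
  qed
  have power: "a ^ n - a' ^ n \<in> I" if "a \<in> A" "a' \<in> A" "a - a' \<in> I" for a a' n
    using that by (induction n) (auto intro: mult I S)
  have prod: "prod f J - prod g J \<in> I"
    if "\<And>j. j \<in> J \<Longrightarrow> f j \<in> A \<and> g j \<in> A \<and> f j - g j \<in> I" for f g and J :: "nat set"
    using that by (induction J rule: infinite_finite_induct) (auto intro: mult I S)
  have sum: "sum f J - sum g J \<in> I"
    if "\<And>j. j \<in> J \<Longrightarrow> f j - g j \<in> I" for f g and J :: "(nat \<Rightarrow>\<^sub>0 nat) set"
    unfolding sum_subtractf[symmetric] using that
    by (induction J rule: infinite_finite_induct) (auto intro: I)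
  show ?thesis
    unfolding mpoly_val_def
  proof (rule sum)
    fix \<mu> assume \<mu>: "\<mu> \<in> Poly_Mapping.keys P"
    have "(\<Prod>i\<in>Poly_Mapping.keys \<mu>. x i ^ Poly_Mapping.lookup \<mu> i) -
      (\<Prod>i\<in>Poly_Mapping.keys \<mu>. y i ^ Poly_Mapping.lookup \<mu> i) \<in> I"
      using polys_in_keys[OF P \<mu>] x d by (intro prod conjI power S) blast+
    then show "of_int (Poly_Mapping.lookup P \<mu>) * (\<Prod>i\<in>Poly_Mapping.keys \<mu>. x i ^ Poly_Mapping.lookup \<mu> i) -
      of_int (Poly_Mapping.lookup P \<mu>) * (\<Prod>i\<in>Poly_Mapping.keys \<mu>. y i ^ Poly_Mapping.lookup \<mu> i) \<in> I"
      unfolding right_diff_distrib[symmetric] by (intro I(3) S)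
  qed
qed

section \<open>Rational numbers with denominators prime to p\<close>

text \<open>The localisation of the integers at \<open>p\<close>. Polynomials expressing algebraic
  numbers through a generator have rational coefficients; their values at integers are taken here
  and reduced modulo \<open>p_multiples p n\<close>.\<close>

definition p_integral :: "nat \<Rightarrow> rat set" where
  "p_integral p = {x. \<exists>a b. \<not> int p dvd b \<and> x = of_int a / of_int b}"

definition p_multiples :: "nat \<Rightarrow> nat \<Rightarrow> rat set" where
  "p_multiples p n = (\<lambda>x. of_int (int p ^ n) * x) ` p_integral p"

context
  fixes p :: nat
  assumes p: "prime p"
begin

lemma subring_p_integral: "subring_set (p_integral p)"
  unfolding subring_set_def
proof (intro conjI ballI)
  have "\<not> int p dvd 1" using p by auto
  then show "1 \<in> p_integral p" unfolding p_integral_def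
    by (intro CollectI exI[of _ 1]) auto
  fix x y assume "x \<in> p_integral p" "y \<in> p_integral p"
  then obtain a b c d where *: "\<not> int p dvd b" "x = of_int a / of_int b"
    "\<not> int p dvd d" "y = of_int c / of_int d"
    unfolding p_integral_def by blast
  then have bd: "\<not> int p dvd b * d" "b \<noteq> 0" "d \<noteq> 0"
    using p prime_dvd_mult_iff[of "int p" b d] by auto
  have "x - y = of_int (a * d - c * b) / of_int (b * d)"
    using *(2,4) bd by (simp add: diff_frac_eq)
  then show "x - y \<in> p_integral p" unfolding p_integral_def using bd by blast
  show "x * y \<in> p_integral p" unfolding p_integral_def
    using * bd by (intro CollectI exI[of _ "a * c"] exI[of _ "b * d"]) auto
qed

lemma p_multiples_0: "0 \<in> p_multiples p n"
  and p_multiples_add: "u \<in> p_multiples p n \<Longrightarrow> v \<in> p_multiples p n \<Longrightarrow> u + v \<in> p_multiples p n"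
  and p_multiples_mult: "a \<in> p_integral p \<Longrightarrow> u \<in> p_multiples p n \<Longrightarrow> a * u \<in> p_multiples p n"
proof -
  note S = subring_set_intros[OF subring_p_integral]
  show "0 \<in> p_multiples p n"
    unfolding p_multiples_def using S(1) by (intro image_eqI[of _ _ 0]) auto
  show "u + v \<in> p_multiples p n" if "u \<in> p_multiples p n" "v \<in> p_multiples p n"
    using that unfolding p_multiples_def by (auto simp: distrib_left[symmetric] intro!: imageI S)
  show "a * u \<in> p_multiples p n" if a: "a \<in> p_integral p" and u: "u \<in> p_multiples p n"
  proof -
    obtain x where x: "x \<in> p_integral p" "u = of_int (int p ^ n) * x"
      using u unfolding p_multiples_def by blast
    show ?thesis unfolding p_multiples_def
      by (rule image_eqI[of _ _ "a * x"]) (use a x in \<open>auto intro: S\<close>)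
  qed
qed

lemma p_multiples_uminus: "u \<in> p_multiples p n \<Longrightarrow> - u \<in> p_multiples p n"
  using p_multiples_mult[of "- 1" u] subring_set_intros[OF subring_p_integral] by simp

lemma p_multiples_diff: "u \<in> p_multiples p n \<Longrightarrow> v \<in> p_multiples p n \<Longrightarrow> u - v \<in> p_multiples p n"
  using p_multiples_add[of u n "- v"] p_multiples_uminus by simp

text \<open>The way back from congruences of rationals to divisibility of integers: the denominator
  is prime to \<open>p\<close>, so clearing it loses nothing.\<close>

lemma of_int_p_multiples: "of_int a \<in> p_multiples p n \<longleftrightarrow> int p ^ n dvd a"
proof
  assume "of_int a \<in> p_multiples p n"
  then obtain c b where b: "\<not> int p dvd b" "of_int a = (of_int (int p ^ n) * (of_int c / of_int b) :: rat)"
    unfolding p_multiples_def p_integral_def by blast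
  then have "b \<noteq> 0" by auto
  then have "(of_int (a * b) :: rat) = of_int (int p ^ n * c)" using b by (simp add: field_simps)
  then have "a * b = int p ^ n * c" by (simp only: of_int_eq_iff)
  then have "int p ^ n dvd a * b" by simp
  moreover have "coprime (int p ^ n) b"
    using p b(1) prime_imp_coprime[of "int p" b] by simp
  ultimately show "int p ^ n dvd a" by (simp add: coprime_dvd_mult_left_iff)
next
  assume "int p ^ n dvd a"
  then obtain c where c: "a = int p ^ n * c" by blast
  show "of_int a \<in> p_multiples p n"
    unfolding p_multiples_def c
    by (rule image_eqI[of _ _ "of_int c"]) (auto intro: subring_set_of_int[OF subring_p_integral])
qed

lemma p_multiples_mono:
  assumes "m \<le> n" shows "p_multiples p n \<subseteq> p_multiples p m"
proof
  fix u assume "u \<in> p_multiples p n"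
  then obtain x where x: "x \<in> p_integral p" "u = of_int (int p ^ n) * x"
    unfolding p_multiples_def by blast
  have "int p ^ n = int p ^ m * int p ^ (n - m)" using assms by (simp add: power_add[symmetric])
  then have "u = of_int (int p ^ m) * (of_int (int p ^ (n - m)) * x)" using x by simp
  moreover have "of_int (int p ^ (n - m)) * x \<in> p_integral p"
    by (rule subring_set_mult[OF subring_p_integral subring_set_of_int[OF subring_p_integral] x(1)])
  ultimately show "u \<in> p_multiples p m"
    unfolding p_multiples_def by blast
qed

text \<open>The denominator is inverted modulo \<open>p ^ n\<close>. The bounds on \<open>y\<close>
  are those of the canonical representatives in \<open>padic_integers\<close>.\<close>

lemma p_integral_residue:
  assumes "x \<in> p_integral p"
  shows "\<exists>y::int. 0 \<le> y \<and> y < int p ^ n \<and> of_int y - x \<in> p_multiples p n"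
proof -
  obtain a b where ab: "\<not> int p dvd b" "x = of_int a / of_int b"
    using assms unfolding p_integral_def by blast
  then have "b \<noteq> 0" by auto
  have "coprime b (int p ^ n)"
    using p ab(1) prime_imp_coprime[of "int p" b] by (simp add: coprime_commute)
  then obtain w where w: "[b * w = 1] (mod (int p ^ n))" using cong_solve_coprime_int by blast
  define y where "y = (a * w) mod int p ^ n"
  have pos: "int p ^ n > 0" using p prime_gt_0_nat by simp
  have "[y * b = a * (b * w)] (mod (int p ^ n))"
    unfolding y_def cong_def by (metis mod_mult_left_eq mult.assoc mult.commute)
  also have "[a * (b * w) = a * 1] (mod (int p ^ n))" using w by (intro cong_mult cong_refl)
  finally obtain c where c: "y * b - a = int p ^ n * c" by (auto simp: cong_iff_dvd_diff)
  have "of_int y - x = of_int (y * b - a) / of_int b"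
    using ab \<open>b \<noteq> 0\<close> by (simp add: diff_divide_distrib)
  also have "\<dots> = of_int (int p ^ n) * (of_int c / of_int b)" unfolding c by simp
  finally have "of_int y - x \<in> p_multiples p n"
    unfolding p_multiples_def p_integral_def using ab(1) by blast
  then show ?thesis using pos by (intro exI[of _ y]) (auto simp: y_def)
qed

end

lemma poly_in_p_integral:
  assumes "prime p" "g \<in> polys_over (p_integral p)"
  shows "poly g (of_int r) \<in> p_integral p"
  using assms subring_set_of_int[OF subring_p_integral]
  by (intro poly_polys_over[OF subring_p_integral subring_p_integral order_refl]) auto

text \<open>The quotient stays in \<open>A\<close>, so points congruent modulo a power of
  \<open>p\<close> have values congruent modulo the same power.\<close>

lemma poly_diff_dvd:
  fixes g :: "'a::comm_ring_1 poly"
  assumes A: "subring_set A" and g: "g \<in> polys_over A" and x: "x \<in> A" "y \<in> A"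
  shows "\<exists>w\<in>A. poly g x - poly g y = w * (x - y)"
  using g
proof (induction g)
  case 0
  then show ?case using subring_set_0[OF A] by (intro bexI[of _ 0]) auto
next
  case (pCons a g)
  have gA: "g \<in> polys_over A"
    unfolding polys_over_def using coeff_polys_over[OF pCons.prems, of "Suc _"] by simp
  then obtain w where w: "w \<in> A" "poly g x - poly g y = w * (x - y)" using pCons.IH by blast
  have "poly (pCons a g) x - poly (pCons a g) y = x * (poly g x - poly g y) + (x - y) * poly g y"
    by (simp add: algebra_simps)
  also have "\<dots> = (x * w + poly g y) * (x - y)" unfolding w(2) by (simp add: algebra_simps)
  finally have "poly (pCons a g) x - poly (pCons a g) y = (x * w + poly g y) * (x - y)" .
  moreover have "x * w + poly g y \<in> A"
    by (intro subring_set_add[OF A] subring_set_mult[OF A] x w(1) poly_polys_over[OF A A order_refl x(2) gA])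
  ultimately show ?case by blast
qed

lemma poly_map_of_int: "poly (map_poly of_int f) (of_int r) = (of_int (poly f r) :: rat)"
  by (induction f) (simp_all add: map_poly_pCons)

lemma common_denominator:
  fixes S :: "rat set"
  assumes "finite S"
  obtains M :: int where "M \<noteq> 0" "\<And>x. x \<in> S \<Longrightarrow> of_int M * x \<in> \<int>"
proof -
  have "\<exists>M::int. M \<noteq> 0 \<and> (\<forall>x\<in>S. of_int M * x \<in> \<int>)"
    using assms
  proof (induction S rule: finite_induct)
    case empty
    then show ?case by (intro exI[of _ 1]) auto
  next
    case (insert x S)
    then obtain M :: int where M: "M \<noteq> 0" "\<forall>x\<in>S. of_int M * x \<in> \<int>" by blast
    obtain a b where ab: "x = of_int a / of_int b" "b > 0" using quotient_of_div quotient_of_denom_pos by (metis surj_pair)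
    have "of_int (M * b) * z \<in> \<int>" if "z \<in> insert x S" for z
    proof (cases "z = x")
      case True
      have "of_int b * x = of_int a" using ab by simp
      moreover have "of_int (M * b) * z = of_int M * (of_int b * x)" by (simp add: True)
      ultimately have "of_int (M * b) * z = of_int (M * a)" by simp
      then show ?thesis by (metis Ints_of_int)
    next
      case False
      then have "of_int M * z \<in> \<int>" using that M by auto
      then have "of_int b * (of_int M * z) \<in> \<int>" by (rule Ints_mult[OF Ints_of_int])
      then show ?thesis by (simp add: mult_ac)
    qed
    then show ?case using M ab by (intro exI[of _ "M * b"]) auto
  qed
  then show thesis using that by blast
qed

lemma p_integralI:
  assumes "M \<noteq> 0" "of_int M * x \<in> \<int>" "\<not> int p dvd M"
  shows "x \<in> p_integral p"
proof -
  obtain a where "of_int M * x = of_int a" using assms(2) by (elim Ints_cases)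
  then have "x = of_int a / of_int M" using assms(1) by (simp add: field_simps)
  then show ?thesis using assms(3) unfolding p_integral_def by blast
qed

text \<open>Each \<open>t\<close> in \<open>T\<close> is the value of \<open>G t\<close> at a common
  generator \<open>\<theta>\<close>; replacing \<open>\<theta>\<close> by a p-adic root of its
  minimal polynomial \<open>f\<close> defines \<open>y\<close>. Equations survive because a
  polynomial vanishing at \<open>\<theta>\<close> is a multiple of \<open>f\<close>, distinctness
  because Bezout identities with \<open>f\<close> survive. Differences \<open>x i - x' i\<close>
  appear because edges are differences, and the conclusion concerns entries so that the operations
  of the p-adic record stay out of the argument.\<close>

theorem algebraic_numbers_to_padic:
  fixes T :: "qbar set"
  assumes "finite T"
  obtains p y where "prime p" "\<And>t. t \<in> T \<Longrightarrow> y t \<in> carrier (padic_integers p)" "inj_on y T"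
    "\<And>P m x x' n. P \<in> polys_in m \<Longrightarrow> (\<And>i. i \<in> {1..m} \<Longrightarrow> x i \<in> T \<and> x' i \<in> T) \<Longrightarrow>
       mpoly_val P (\<lambda>i. x i - x' i) = 0 \<Longrightarrow>
       int p ^ Suc n dvd mpoly_val P (\<lambda>i. y (x i) n - y (x' i) n)"
proof -
  obtain \<theta> where \<theta>: "T \<subseteq> qadj \<theta>" using primitive_element[OF assms] .
  have "\<forall>t\<in>T. \<exists>g. rpoly g \<theta> = t" using \<theta> by (auto simp: qadj_def)
  then obtain G where G: "\<And>t. t \<in> T \<Longrightarrow> rpoly (G t) \<theta> = t" by metis
  obtain f where f: "rpoly f \<theta> = 0" "degree f > 0" "lead_coeff f = 1"
    "\<And>g. rpoly g \<theta> = 0 \<Longrightarrow> f dvd g" "\<And>g. rpoly g \<theta> \<noteq> 0 \<Longrightarrow> \<exists>u v. u * f + v * g = 1"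
    using minimal_poly[of \<theta>] by metis
  \<comment> \<open>Certifies later that a root of \<open>f\<close> modulo \<open>p\<close> is
    simple.\<close>
  obtain u0 v0 where uv0: "u0 * f + v0 * pderiv f = 1"
    using f(5)[OF minimal_poly_separable[OF f(2,4)]] by blast
  have "\<forall>a\<in>T. \<forall>b\<in>T. \<exists>u v. a \<noteq> b \<longrightarrow> u * f + v * (G a - G b) = 1"
  proof (intro ballI)
    fix a b assume ab: "a \<in> T" "b \<in> T"
    show "\<exists>u v. a \<noteq> b \<longrightarrow> u * f + v * (G a - G b) = 1"
    proof (cases "a = b")
      case False
      then have "rpoly (G a - G b) \<theta> \<noteq> 0" using G ab by simp
      then show ?thesis using f(5) by blast
    qed simp
  qed
  then obtain U V where UV: "\<And>a b. a \<in> T \<Longrightarrow> b \<in> T \<Longrightarrow> a \<noteq> b \<Longrightarrow> U a b * f + V a b * (G a - G b) = 1"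
    by metis
  \<comment> \<open>The polynomials whose coefficients must be integral at \<open>p\<close>;
    \<open>M\<close> will clear all their denominators at once.\<close>
  define Q where "Q = {f, u0, v0} \<union> G ` T \<union> case_prod U ` (T \<times> T) \<union> case_prod V ` (T \<times> T)"
  have "finite Q" using assms by (simp add: Q_def)
  then have "finite (\<Union>q\<in>Q. coeff q ` {..degree q})" by blast
  then obtain M :: int where M: "M \<noteq> 0" "\<And>x. x \<in> (\<Union>q\<in>Q. coeff q ` {..degree q}) \<Longrightarrow> of_int M * x \<in> \<int>"
    using common_denominator by metis
  have M': "of_int M * coeff q i \<in> \<int>" if "q \<in> Q" for q i
  proof (cases "i \<le> degree q")
    case True
    then show ?thesis using M(2) that by blast
  next
    case False
    then show ?thesis by (simp add: coeff_eq_0)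
  qed
  \<comment> \<open>The floor is exact, since \<open>M\<close> clears the denominators of
    \<open>f\<close>.\<close>
  define F where "F = map_poly (\<lambda>x. \<lfloor>of_int M * x\<rfloor>) f"
  have F: "map_poly of_int F = smult (of_int M) f"
    using M'[of f] by (intro poly_eqI) (auto simp: F_def Q_def coeff_map_poly elim!: Ints_cases)
  have Feval: "of_int (poly F r) = of_int M * poly f (of_int r)" for r
  proof -
    have "of_int (poly F r) = poly (map_poly of_int F) (of_int r :: rat)"
      by (rule poly_map_of_int[symmetric])
    then show ?thesis unfolding F by simp
  qed
  have dF: "map_poly of_int (pderiv F) = smult (of_int M) (pderiv f)"
  proof -
    have "map_poly of_int (pderiv F) = pderiv (map_poly of_int F :: rat poly)"
      by (rule poly_eqI) (simp add: coeff_pderiv coeff_map_poly)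
    then show ?thesis unfolding F by (simp add: pderiv_smult)
  qed
  have dFeval: "of_int (poly (pderiv F) r) = of_int M * poly (pderiv f) (of_int r)" for r
  proof -
    have "of_int (poly (pderiv F) r) = poly (map_poly of_int (pderiv F)) (of_int r :: rat)"
      by (rule poly_map_of_int[symmetric])
    then show ?thesis unfolding dF by simp
  qed
  have "degree (map_poly of_int F :: rat poly) > 0" unfolding F using M f by simp
  moreover have "degree (map_poly of_int F :: rat poly) \<le> degree F"
    by (intro degree_le) (simp add: coeff_map_poly coeff_eq_0)
  ultimately have "degree F > 0" by linarith
  then obtain p r0 where p: "prime p" "\<not> int p dvd M" and r0: "int p dvd poly F r0"
    using prime_dividing_value M(1) by metis
  define B where "B = p_integral p"
  define I where "I n = p_multiples p n" for n
  have B: "subring_set B" unfolding B_def by (rule subring_p_integral[OF p(1)])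
  note S = subring_set_intros[OF B]
  note SP = subring_set_intros[OF subring_set_polys_over[OF B]]
  have I: "0 \<in> I n" "u \<in> I n \<Longrightarrow> v \<in> I n \<Longrightarrow> u + v \<in> I n" "u \<in> I n \<Longrightarrow> v \<in> I n \<Longrightarrow> u - v \<in> I n"
    "a \<in> B \<Longrightarrow> u \<in> I n \<Longrightarrow> a * u \<in> I n" for a u v n
    unfolding I_def B_def
    using p_multiples_0[OF p(1)] p_multiples_add[OF p(1)] p_multiples_diff[OF p(1)]
      p_multiples_mult[OF p(1)] by blast+
  have QO: "q \<in> polys_over B" if "q \<in> Q" for q
    unfolding polys_over_def B_def using p_integralI[OF M(1) M' p(2)] that by blast
  have evO: "poly q (of_int r) \<in> B" if "q \<in> polys_over B" for q r
    using poly_in_p_integral[OF p(1)] that unfolding B_def by blast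
  have one: "1 \<notin> I 1"
    using of_int_p_multiples[OF p(1), of 1 1] p(1) by (auto simp: I_def)
  have Minv: "inverse (of_int M) \<in> B"
    unfolding B_def using M(1) p(2) by (intro p_integralI[of M]) auto
  have divM: "x \<in> I n" if "of_int M * x \<in> I n" for x n
  proof -
    have "inverse (of_int M) * (of_int M * x) \<in> I n" using Minv that by (rule I(4))
    then show ?thesis using M(1) by (simp add: mult.assoc[symmetric])
  qed
  have intI: "of_int a \<in> I n \<longleftrightarrow> int p ^ n dvd a" for a n
    unfolding I_def by (rule of_int_p_multiples[OF p(1)])
  have fr0: "poly f (of_int r0) \<in> I 1"
    by (rule divM) (use r0 in \<open>simp add: Feval[symmetric] intI\<close>)
  \<comment> \<open>A common root of \<open>f\<close> and its derivative modulo \<open>p\<close>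
    would, by the identity \<open>uv0\<close>, make 1 divisible by \<open>p\<close>.\<close>
  have "\<not> int p dvd poly (pderiv F) r0"
  proof
    assume *: "int p dvd poly (pderiv F) r0"
    have "poly (pderiv f) (of_int r0) \<in> I 1"
      by (rule divM) (use * in \<open>simp add: dFeval[symmetric] intI\<close>)
    then have "poly (u0 * f + v0 * pderiv f) (of_int r0) \<in> I 1"
      using fr0 by (auto simp: Q_def intro!: I evO QO)
    then show False using one unfolding uv0 by simp
  qed
  then obtain r where r: "r 0 = r0" "\<And>n. int p ^ Suc n dvd poly F (r n)"
    "\<And>n. int p ^ Suc n dvd r (Suc n) - r n"
    using hensel[OF p(1) r0] by metis
  have fr: "poly f (of_int (r n)) \<in> I (Suc n)" for n
    by (rule divM) (use r(2)[of n] in \<open>simp add: Feval[symmetric] intI del: power_Suc\<close>)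
  have GO: "G t \<in> polys_over B" if "t \<in> T" for t using that by (intro QO) (auto simp: Q_def)
  \<comment> \<open>Entry \<open>n\<close> of the image of \<open>t\<close> is the canonical residue
    of the value of \<open>G t\<close> at the approximation \<open>r n\<close>.\<close>
  have "\<exists>z. 0 \<le> z \<and> z < int p ^ Suc n \<and> of_int z - poly (G t) (of_int (r n)) \<in> I (Suc n)" if "t \<in> T" for t n
    unfolding I_def using evO[OF GO[OF that]] by (intro p_integral_residue[OF p(1)]) (simp add: B_def)
  then obtain y where y: "\<And>t n. t \<in> T \<Longrightarrow> 0 \<le> y t n" "\<And>t n. t \<in> T \<Longrightarrow> y t n < int p ^ Suc n"
    "\<And>t n. t \<in> T \<Longrightarrow> of_int (y t n) - poly (G t) (of_int (r n)) \<in> I (Suc n)"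
    by metis
  show thesis
  proof (rule that[OF p(1)])
    fix t assume t: "t \<in> T"
    have "y t (Suc n) mod int p ^ Suc n = y t n" for n
    proof -
      obtain w where w: "w \<in> B" "poly (G t) (of_int (r (Suc n))) - poly (G t) (of_int (r n)) =
          w * (of_int (r (Suc n)) - of_int (r n))"
        using poly_diff_dvd[OF B GO[OF t]] S(11) by metis
      have "w * of_int (r (Suc n) - r n) \<in> I (Suc n)"
        using w r(3)[of n] by (intro I) (simp_all only: intI)
      then have a1: "poly (G t) (of_int (r (Suc n))) - poly (G t) (of_int (r n)) \<in> I (Suc n)"
        unfolding w(2) by simp
      have a2: "of_int (y t (Suc n)) - poly (G t) (of_int (r (Suc n))) \<in> I (Suc n)"
        using y(3)[OF t, of "Suc n"] p_multiples_mono[OF p(1), of "Suc n" "Suc (Suc n)"]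
        unfolding I_def by auto
      \<comment> \<open>From \<open>y t (Suc n)\<close> to \<open>y t n\<close> by way of the values
        of \<open>G t\<close> at \<open>r (Suc n)\<close> and \<open>r n\<close>.\<close>
      have "(of_int (y t (Suc n)) - poly (G t) (of_int (r (Suc n)))) +
         (poly (G t) (of_int (r (Suc n))) - poly (G t) (of_int (r n))) -
         (of_int (y t n) - poly (G t) (of_int (r n))) \<in> I (Suc n)"
        by (rule I(3)[OF I(2)[OF a2 a1] y(3)[OF t]])
      then have "of_int (y t (Suc n) - y t n) \<in> I (Suc n)" by simp
      then have "int p ^ Suc n dvd y t (Suc n) - y t n" by (simp only: intI)
      then have "y t (Suc n) mod int p ^ Suc n = y t n mod int p ^ Suc n"
        by (simp only: mod_eq_dvd_iff)
      then show ?thesis using y(1,2)[OF t, of n] by (simp del: power_Suc)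
    qed
    then show "y t \<in> carrier (padic_integers p)"
      unfolding padic_integers_simps(1) using y(1,2)[OF t] by blast
  next
    show "inj_on y T"
    proof (rule inj_onI, rule ccontr)
      fix a b assume ab: "a \<in> T" "b \<in> T" "y a = y b" "a \<noteq> b"
      \<comment> \<open>The residues modulo \<open>p\<close>, which are the entries 0, already
        separate the points of \<open>T\<close>.\<close>
      have "(of_int (y b 0) - poly (G b) (of_int (r 0))) - (of_int (y a 0) - poly (G a) (of_int (r 0))) \<in> I (Suc 0)"
        using ab by (intro I(3) y(3))
      then have "poly (G a - G b) (of_int r0) \<in> I 1" using ab r(1) by simp
      moreover have "U a b \<in> Q" "V a b \<in> Q" using ab by (auto simp: Q_def)
      ultimately have "poly (U a b * f + V a b * (G a - G b)) (of_int r0) \<in> I 1"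
        unfolding poly_add poly_mult using fr0 by (intro I evO QO)
      then show False using one UV[OF ab(1,2,4)] by simp
    qed
  next
    fix P m x x' n
    assume P: "P \<in> polys_in m" and x: "\<And>i. i \<in> {1..m} \<Longrightarrow> x i \<in> T \<and> x' i \<in> T"
      and zero: "mpoly_val P (\<lambda>i. x i - x' i) = 0"
    define H where "H = mpoly_val P (\<lambda>i. G (x i) - G (x' i))"
    have HO: "H \<in> polys_over B"
      unfolding H_def using x GO by (intro mpoly_val_closed[OF subring_set_polys_over[OF B] P] SP) auto
    have "rpoly H \<theta> = mpoly_val P (\<lambda>i. rpoly (G (x i) - G (x' i)) \<theta>)"
      unfolding H_def by (rule mpoly_val_hom[OF subring_set_UNIV rpoly_ring_hom P]) simp
    also have "\<dots> = mpoly_val P (\<lambda>i. x i - x' i)"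
      using x G by (intro mpoly_val_cong[OF P]) simp
    finally have "f dvd H" using zero f(4) by simp
    have fO: "f \<in> polys_over B" by (rule QO) (simp add: Q_def)
    \<comment> \<open>\<open>f\<close> is monic, so the quotient of \<open>H\<close> by
      \<open>f\<close> has coefficients in \<open>B\<close>, and divisibility of the values of
      \<open>f\<close> passes to those of \<open>H\<close>.\<close>
    obtain k q s where qs: "q \<in> polys_over B" "smult (lead_coeff f ^ k) H = q * f + s"
      "s = 0 \<or> degree s < degree f"
      using pseudo_division_over[OF B fO _ HO] f(2) by (metis degree_0 less_irrefl)
    have Hqs: "H = q * f + s" using qs(2) f(3) by simp
    then have "f dvd s" using \<open>f dvd H\<close> by (metis dvd_add_right_iff dvd_triv_right)
    then have "s = 0" using qs(3) dvd_imp_degree_le[of f s] by (metis not_le)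
    then have "poly H (of_int (r n)) = poly q (of_int (r n)) * poly f (of_int (r n))"
      using Hqs by simp
    then have "poly H (of_int (r n)) \<in> I (Suc n)" using fr evO[OF qs(1)] by (auto intro: I)
    moreover have "poly H (of_int (r n)) = mpoly_val P (\<lambda>i. poly (G (x i) - G (x' i)) (of_int (r n)))"
      unfolding H_def
      by (rule mpoly_val_hom[OF subring_set_UNIV _ P, where h = "\<lambda>q. poly q (of_int (r n))"])
         (simp_all add: ring_hom_on_def)
    moreover have "mpoly_val P (\<lambda>i. of_int (y (x i) n - y (x' i) n)) -
       mpoly_val P (\<lambda>i. poly (G (x i) - G (x' i)) (of_int (r n))) \<in> I (Suc n)"
    proof (rule mpoly_val_congruent[OF B _ _ _ P])
      fix i assume i: "i \<in> {1..m}"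
      show "poly (G (x i) - G (x' i)) (of_int (r n)) \<in> B"
        using x[OF i] GO by (intro evO SP) auto
      have "(of_int (y (x i) n) - poly (G (x i)) (of_int (r n))) -
         (of_int (y (x' i) n) - poly (G (x' i)) (of_int (r n))) \<in> I (Suc n)"
        using x[OF i] by (intro I(3) y(3)) auto
      then show "of_int (y (x i) n - y (x' i) n) - poly (G (x i) - G (x' i)) (of_int (r n)) \<in> I (Suc n)"
        by (simp add: algebra_simps)
    qed (auto intro: I S(3,11))
    ultimately have "mpoly_val P (\<lambda>i. of_int (y (x i) n - y (x' i) n)) \<in> I (Suc n)"
      using I(2) by fastforce
    then show "int p ^ Suc n dvd mpoly_val P (\<lambda>i. y (x i) n - y (x' i) n)"
      unfolding mpoly_val_of_int intI .
  qed
qed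

section \<open>Colourings of the Cayley graphs\<close>

context prime_ideal_on
begin

text \<open>The element not to be killed is the product \<open>s\<close> of all differences of
  distinct points of \<open>T\<close>; it lies outside \<open>P\<close> because \<open>P\<close> is
  prime.\<close>

corollary finitely_generated_inj_hom:
  assumes T: "finite T" "T \<subseteq> U"
    and char0: "\<And>n. of_int n \<in> P \<Longrightarrow> n = 0"
    and inj: "\<And>a b. a \<in> T \<Longrightarrow> b \<in> T \<Longrightarrow> a - b \<in> P \<Longrightarrow> a = b"
  obtains h :: "'a \<Rightarrow> 'k::{alg_closed_field, field_char_0}"
  where "ring_hom_on (subring_set hull T) h" "\<And>x. x \<in> subring_set hull T \<Longrightarrow> x \<in> P \<Longrightarrow> h x = 0"
    "inj_on h T"
proof -
  define D where "D = {(a, b) \<in> T \<times> T. a \<noteq> b}"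
  define s where "s = (\<Prod>(a, b)\<in>D. a - b)"
  have D: "finite D" using T finite_subset[of D "T \<times> T"] by (auto simp: D_def)
  have hull: "subring_set (subring_set hull T)" by (rule subring_set_hull)
  have Th: "T \<subseteq> subring_set hull T" by (rule hull_subset)
  have DH: "(case d of (a, b) \<Rightarrow> a - b) \<in> subring_set hull T" if "d \<in> D" for d
    using that Th by (auto simp: D_def intro!: subring_set_diff[OF hull])
  have "s \<in> subring_set hull T"
    unfolding s_def using DH by (rule subring_set_prod[OF hull])
  moreover have "s \<notin> P"
    unfolding s_def using T inj by (intro P_prod D) (auto simp: D_def intro!: subring_set_diff[OF subring_U])
  ultimately obtain h :: "'a \<Rightarrow> 'k" where h: "ring_hom_on (subring_set hull T) h"
    "\<forall>x\<in>(subring_set hull T) \<inter> P. h x = 0" "h s \<noteq> 0"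
    using finitely_generated_hom[OF T _ _ char0, where 'k = 'k] by blast
  have "h s = (\<Prod>d\<in>D. h (case d of (a, b) \<Rightarrow> a - b))"
    unfolding s_def using DH by (rule ring_hom_on_prod[OF hull h(1)])
  then have nz: "h (a - b) \<noteq> 0" if "a \<in> T" "b \<in> T" "a \<noteq> b" for a b
    using h(3) D that by (auto simp: D_def)
  have "inj_on h T"
  proof (rule inj_onI, rule ccontr)
    fix a b assume ab: "a \<in> T" "b \<in> T" "h a = h b" "a \<noteq> b"
    then have "h (a - b) = 0"
      using Th by (subst ring_hom_on_diff[OF hull h(1)]) auto
    then show False using nz ab by blast
  qed
  then show thesis using that h by blast
qed

end

section \<open>Cayley graphs of affine spaces\<close>

lemma Cay_edge_iff:
  assumes "group \<Gamma>" "S \<subseteq> carrier \<Gamma>"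
  shows "(x, y) \<in> snd (Cay \<Gamma> S) \<longleftrightarrow> x \<in> carrier \<Gamma> \<and> y \<in> carrier \<Gamma> \<and> x \<noteq> y \<and>
    (x \<otimes>\<^bsub>\<Gamma>\<^esub> inv\<^bsub>\<Gamma>\<^esub> y \<in> S \<or> y \<otimes>\<^bsub>\<Gamma>\<^esub> inv\<^bsub>\<Gamma>\<^esub> x \<in> S)"
proof -
  interpret group \<Gamma> by fact
  have "x \<otimes>\<^bsub>\<Gamma>\<^esub> inv\<^bsub>\<Gamma>\<^esub> y \<in> m_inv \<Gamma> ` S \<longleftrightarrow> y \<otimes>\<^bsub>\<Gamma>\<^esub> inv\<^bsub>\<Gamma>\<^esub> x \<in> S"
    if xy: "x \<in> carrier \<Gamma>" "y \<in> carrier \<Gamma>"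
  proof -
    have e: "inv\<^bsub>\<Gamma>\<^esub> (x \<otimes>\<^bsub>\<Gamma>\<^esub> inv\<^bsub>\<Gamma>\<^esub> y) = y \<otimes>\<^bsub>\<Gamma>\<^esub> inv\<^bsub>\<Gamma>\<^esub> x"
      "inv\<^bsub>\<Gamma>\<^esub> (y \<otimes>\<^bsub>\<Gamma>\<^esub> inv\<^bsub>\<Gamma>\<^esub> x) = x \<otimes>\<^bsub>\<Gamma>\<^esub> inv\<^bsub>\<Gamma>\<^esub> y"
      using xy by (simp_all add: inv_mult_group)
    show ?thesis
    proof
      assume "x \<otimes>\<^bsub>\<Gamma>\<^esub> inv\<^bsub>\<Gamma>\<^esub> y \<in> m_inv \<Gamma> ` S"
      then obtain s where s: "s \<in> S" "x \<otimes>\<^bsub>\<Gamma>\<^esub> inv\<^bsub>\<Gamma>\<^esub> y = inv\<^bsub>\<Gamma>\<^esub> s" by blast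
      then show "y \<otimes>\<^bsub>\<Gamma>\<^esub> inv\<^bsub>\<Gamma>\<^esub> x \<in> S" using e(1) assms(2) by auto
    next
      assume "y \<otimes>\<^bsub>\<Gamma>\<^esub> inv\<^bsub>\<Gamma>\<^esub> x \<in> S"
      then show "x \<otimes>\<^bsub>\<Gamma>\<^esub> inv\<^bsub>\<Gamma>\<^esub> y \<in> m_inv \<Gamma> ` S" using e(2) by (metis imageI)
    qed
  qed
  then show ?thesis by (auto simp: Cay_def)
qed

lemma colourable_Cay_if_finite:
  assumes "\<And>W. finite W \<Longrightarrow> W \<subseteq> carrier \<Gamma> \<Longrightarrow> colourable (W, snd (Cay \<Gamma> S)) k"
  shows "colourable (Cay \<Gamma> S) k"
  using de_Bruijn_Erdos[OF assms] by (simp add: Cay_def)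

text \<open>Injectivity on \<open>W\<close> is needed beside the condition on differences: the
  neutral element may lie in \<open>S'\<close>, and endpoints that collapse are not
  adjacent.\<close>

lemma colourable_Cay_embedding:
  assumes \<Gamma>: "group \<Gamma>" "S \<subseteq> carrier \<Gamma>" and \<Delta>: "group \<Delta>" "S' \<subseteq> carrier \<Delta>"
    and f: "\<And>x. x \<in> W \<Longrightarrow> f x \<in> carrier \<Delta>" "inj_on f W"
      "\<And>x y. x \<in> W \<Longrightarrow> y \<in> W \<Longrightarrow> x \<otimes>\<^bsub>\<Gamma>\<^esub> inv\<^bsub>\<Gamma>\<^esub> y \<in> S \<Longrightarrow> f x \<otimes>\<^bsub>\<Delta>\<^esub> inv\<^bsub>\<Delta>\<^esub> f y \<in> S'"
    and col: "colourable (Cay \<Delta> S') k"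
  shows "colourable (W, snd (Cay \<Gamma> S)) k"
proof (rule colourable_mono_hom[OF col, of f])
  show "f ` fst (W, snd (Cay \<Gamma> S)) \<subseteq> fst (Cay \<Delta> S')" using f(1) by (auto simp: Cay_def)
  fix x y assume xy: "x \<in> fst (W, snd (Cay \<Gamma> S))" "y \<in> fst (W, snd (Cay \<Gamma> S))"
    "(x, y) \<in> snd (W, snd (Cay \<Gamma> S))"
  then have "f x \<noteq> f y"
    using inj_onD[OF f(2)] by (auto simp: Cay_edge_iff[OF \<Gamma>])
  then show "(f x, f y) \<in> snd (Cay \<Delta> S')"
    using xy f(1,3) by (auto simp: Cay_edge_iff[OF \<Gamma>] Cay_edge_iff[OF \<Delta>])
qed

lemma carrier_affine_space: "carrier (affine_space R m) = (\<Pi>\<^sub>E i\<in>{1..m}. carrier R)"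
  by (simp add: affine_space_def)

lemma int_points_subset: "int_points R m \<P> \<subseteq> carrier (affine_space R m)"
  by (auto simp: int_points_def zero_locus_def)

context
  fixes R :: "('a, 'b) ring_scheme" and m :: nat
  assumes R: "cring R"
begin

interpretation cring R by (rule R)

lemma group_affine_space: "group (affine_space R m)"
  unfolding affine_space_def by (intro product_group) (rule add.is_group)

lemma affine_space_diff:
  assumes "x \<in> carrier (affine_space R m)" "y \<in> carrier (affine_space R m)"
  shows "x \<otimes>\<^bsub>affine_space R m\<^esub> inv\<^bsub>affine_space R m\<^esub> y = (\<lambda>i\<in>{1..m}. x i \<ominus>\<^bsub>R\<^esub> y i)"
proof -
  have "inv\<^bsub>affine_space R m\<^esub> y = (\<lambda>i\<in>{1..m}. \<ominus>\<^bsub>R\<^esub> y i)"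
    using assms(2) unfolding affine_space_def a_inv_def
    by (subst inv_product_group) (auto intro: add.is_group)
  then show ?thesis by (auto simp: affine_space_def a_minus_def fun_eq_iff)
qed

lemma diff_in_int_points_iff:
  assumes "x \<in> carrier (affine_space R m)" "y \<in> carrier (affine_space R m)"
  shows "x \<otimes>\<^bsub>affine_space R m\<^esub> inv\<^bsub>affine_space R m\<^esub> y \<in> int_points R m \<P> \<longleftrightarrow>
    (\<forall>P\<in>\<P>. eval_poly R (\<lambda>c. add_pow R c \<one>\<^bsub>R\<^esub>) P (\<lambda>i\<in>{1..m}. x i \<ominus>\<^bsub>R\<^esub> y i) = \<zero>\<^bsub>R\<^esub>)"
proof -
  have "x \<otimes>\<^bsub>affine_space R m\<^esub> inv\<^bsub>affine_space R m\<^esub> y \<in> carrier (affine_space R m)"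
    using assms group_affine_space by (meson group.inv_closed group.is_monoid monoid.m_closed)
  then show ?thesis unfolding int_points_def zero_locus_def by (simp add: affine_space_diff[OF assms])
qed

end

lemma complex_ring_simps:
  "carrier complex_ring = UNIV" "\<zero>\<^bsub>complex_ring\<^esub> = 0" "\<one>\<^bsub>complex_ring\<^esub> = 1"
  "a \<otimes>\<^bsub>complex_ring\<^esub> b = a * b" "a \<oplus>\<^bsub>complex_ring\<^esub> b = a + b"
  by (simp_all add: ring_of_type_algebra_def)

lemma complex_ring_uminus: "\<ominus>\<^bsub>complex_ring\<^esub> a = - a"
proof -
  interpret cring complex_ring by (rule cring_from_type_algebra)
  show ?thesis by (rule minus_equality) (simp_all add: complex_ring_simps)
qed

lemma complex_ring_add_pow: "add_pow complex_ring (c :: int) \<one>\<^bsub>complex_ring\<^esub> = of_int c"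
proof -
  interpret cring complex_ring by (rule cring_from_type_algebra)
  have nat: "add_pow complex_ring (n :: nat) 1 = of_nat n" for n
    by (induction n) (simp_all add: add_pow_def complex_ring_simps)
  show ?thesis
  proof (cases "c \<ge> 0")
    case True
    then show ?thesis using nat[of "nat c"] by (simp add: add_pow_int_ge complex_ring_simps)
  next
    case False
    then show ?thesis using nat[of "nat (- c)"]
      by (simp add: add_pow_int_lt complex_ring_simps complex_ring_uminus)
  qed
qed

lemma eval_poly_complex_eq_mpoly_val:
  "eval_poly complex_ring (\<lambda>c. add_pow complex_ring c \<one>\<^bsub>complex_ring\<^esub>) P x = mpoly_val P x"
  by (simp only: eval_poly_complex complex_ring_add_pow mpoly_val_def)

section \<open>Arithmetic of p-adic integers, entry by entry\<close>

context
  fixes p :: nat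
  assumes p: "prime p"
begin

interpretation Zp: cring "padic_integers p" by (rule cring_padic_integers[OF p])

lemma padic_mod: "x \<in> carrier (padic_integers p) \<Longrightarrow> x n mod int p ^ Suc n = x n"
  by (simp add: padic_integers_simps(1) del: power_Suc)

lemma padic_one_mod: "1 mod int p ^ Suc n = 1"
  using padic_mod[OF Zp.one_closed] by (simp add: padic_integers_simps)

lemma padic_uminus:
  assumes x: "x \<in> carrier (padic_integers p)"
  shows "(\<ominus>\<^bsub>padic_integers p\<^esub> x) n = (- x n) mod int p ^ Suc n"
proof -
  define z where "z = \<ominus>\<^bsub>padic_integers p\<^esub> x"
  have z: "z \<in> carrier (padic_integers p)" using x by (simp add: z_def)
  have "x \<oplus>\<^bsub>padic_integers p\<^esub> z = \<zero>\<^bsub>padic_integers p\<^esub>" using x by (simp add: z_def Zp.r_neg)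
  then have "(x n + z n) mod int p ^ Suc n = 0" unfolding padic_integers_simps by metis
  then have "int p ^ Suc n dvd z n - (- x n)" by (simp add: mod_eq_0_iff_dvd add.commute del: power_Suc)
  then have "z n mod int p ^ Suc n = (- x n) mod int p ^ Suc n" by (simp only: mod_eq_dvd_iff)
  then show ?thesis using padic_mod[OF z] by (simp add: z_def del: power_Suc)
qed

lemma padic_minus:
  assumes "x \<in> carrier (padic_integers p)" "y \<in> carrier (padic_integers p)"
  shows "(x \<ominus>\<^bsub>padic_integers p\<^esub> y) n = (x n - y n) mod int p ^ Suc n"
  using assms(2)
  by (simp add: a_minus_def padic_integers_simps(5) padic_uminus mod_add_right_eq del: power_Suc)

lemma padic_power:
  "(x [^]\<^bsub>padic_integers p\<^esub> (k :: nat)) n = x n ^ k mod int p ^ Suc n"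
proof (induction k)
  case 0
  then show ?case by (simp add: padic_integers_simps(3) padic_one_mod del: power_Suc)
next
  case (Suc k)
  have "(x [^]\<^bsub>padic_integers p\<^esub> Suc k) n = (x [^]\<^bsub>padic_integers p\<^esub> k) n * x n mod int p ^ Suc n"
    by (simp add: padic_integers_simps(2) del: power_Suc)
  then show ?case by (simp only: Suc mod_mult_left_eq power_Suc2)
qed

lemma padic_finprod:
  assumes "finite A" "\<And>i. i \<in> A \<Longrightarrow> g i \<in> carrier (padic_integers p)"
  shows "(\<Otimes>\<^bsub>padic_integers p\<^esub>i\<in>A. g i) n = (\<Prod>i\<in>A. g i n) mod int p ^ Suc n"
  using assms
  by (induction A rule: finite_induct)
     (simp_all add: padic_integers_simps(2,3) padic_one_mod mod_mult_right_eq Pi_def del: power_Suc)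

lemma padic_finsum:
  assumes "finite A" "\<And>i. i \<in> A \<Longrightarrow> g i \<in> carrier (padic_integers p)"
  shows "(\<Oplus>\<^bsub>padic_integers p\<^esub>i\<in>A. g i) n = (\<Sum>i\<in>A. g i n) mod int p ^ Suc n"
  using assms
  by (induction A rule: finite_induct)
     (simp_all add: padic_integers_simps(4,5) mod_add_right_eq Pi_def del: power_Suc)

lemma padic_add_pow:
  "(add_pow (padic_integers p) (c :: int) \<one>\<^bsub>padic_integers p\<^esub>) n = c mod int p ^ Suc n"
proof -
  have nat: "(add_pow (padic_integers p) (k :: nat) \<one>\<^bsub>padic_integers p\<^esub>) n = int k mod int p ^ Suc n" for k
  proof (induction k)
    case 0
    then show ?case by (simp add: padic_integers_simps(4))
  next
    case (Suc k)
    have "add_pow (padic_integers p) (Suc k) \<one>\<^bsub>padic_integers p\<^esub> =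
        add_pow (padic_integers p) k \<one>\<^bsub>padic_integers p\<^esub> \<oplus>\<^bsub>padic_integers p\<^esub> \<one>\<^bsub>padic_integers p\<^esub>"
      by simp
    then show ?case using Suc
      by (simp add: padic_integers_simps(3,5) mod_add_left_eq mod_add_right_eq add.commute del: power_Suc)
  qed
  show ?thesis
  proof (cases "c \<ge> 0")
    case True
    then show ?thesis using nat[of "nat c"] by (simp add: add_pow_int_ge del: power_Suc)
  next
    case False
    then show ?thesis using nat[of "nat (- c)"]
      by (simp add: add_pow_int_lt padic_uminus mod_minus_eq del: power_Suc)
  qed
qed

text \<open>Taking entry \<open>n\<close> turns each ring operation into that of the integers
  followed by a reduction, and the inner reductions are absorbed into the last one.\<close>

lemma eval_poly_padic:
  assumes P: "P \<in> polys_in m" and x: "\<And>i. i \<in> {1..m} \<Longrightarrow> x i \<in> carrier (padic_integers p)"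
  shows "eval_poly (padic_integers p) (\<lambda>c. add_pow (padic_integers p) c \<one>\<^bsub>padic_integers p\<^esub>) P x n =
    mpoly_val P (\<lambda>i. x i n) mod int p ^ Suc n"
proof -
  have x': "x i \<in> carrier (padic_integers p)"
    if "\<mu> \<in> Poly_Mapping.keys P" "i \<in> Poly_Mapping.keys \<mu>" for \<mu> i
    using x polys_in_keys[OF P that] .
  have pr: "(\<Otimes>\<^bsub>padic_integers p\<^esub>i\<in>Poly_Mapping.keys \<mu>. x i [^]\<^bsub>padic_integers p\<^esub> Poly_Mapping.lookup \<mu> i) n =
     (\<Prod>i\<in>Poly_Mapping.keys \<mu>. x i n ^ Poly_Mapping.lookup \<mu> i) mod int p ^ Suc n"
    if "\<mu> \<in> Poly_Mapping.keys P" for \<mu>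
    using x'[OF that] by (subst padic_finprod) (simp_all add: padic_power mod_prod_eq del: power_Suc)
  have pc: "(\<Otimes>\<^bsub>padic_integers p\<^esub>i\<in>Poly_Mapping.keys \<mu>. x i [^]\<^bsub>padic_integers p\<^esub> Poly_Mapping.lookup \<mu> i)
     \<in> carrier (padic_integers p)" if "\<mu> \<in> Poly_Mapping.keys P" for \<mu>
    using x'[OF that] by (intro Zp.finprod_closed) auto
  have ap: "add_pow (padic_integers p) (c :: int) \<one>\<^bsub>padic_integers p\<^esub> \<in> carrier (padic_integers p)" for c
    by simp
  have "eval_poly (padic_integers p) (\<lambda>c. add_pow (padic_integers p) c \<one>\<^bsub>padic_integers p\<^esub>) P x n =
    (\<Sum>\<mu>\<in>Poly_Mapping.keys P. (add_pow (padic_integers p) (Poly_Mapping.lookup P \<mu>) \<one>\<^bsub>padic_integers p\<^esub>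
      \<otimes>\<^bsub>padic_integers p\<^esub> (\<Otimes>\<^bsub>padic_integers p\<^esub>i\<in>Poly_Mapping.keys \<mu>.
         x i [^]\<^bsub>padic_integers p\<^esub> Poly_Mapping.lookup \<mu> i)) n) mod int p ^ Suc n"
    unfolding eval_poly_def by (rule padic_finsum) (use pc ap in auto)
  also have "\<dots> = (\<Sum>\<mu>\<in>Poly_Mapping.keys P. (Poly_Mapping.lookup P \<mu> *
     (\<Prod>i\<in>Poly_Mapping.keys \<mu>. x i n ^ Poly_Mapping.lookup \<mu> i)) mod int p ^ Suc n) mod int p ^ Suc n"
    using pr by (simp add: padic_integers_simps(2) padic_add_pow mod_mult_eq del: power_Suc cong: sum.cong)
  also have "\<dots> = mpoly_val P (\<lambda>i. x i n) mod int p ^ Suc n"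
    by (simp add: mod_sum_eq mpoly_val_def del: power_Suc)
  finally show ?thesis .
qed

text \<open>Edges become divisibilities of integers without inner reductions, the form in which
  \<open>algebraic_numbers_to_padic\<close> produces them.\<close>

lemma diff_in_int_points_padic_iff:
  assumes \<P>: "\<P> \<subseteq> polys_in m"
    and x: "x \<in> carrier (affine_space (padic_integers p) m)"
    and y: "y \<in> carrier (affine_space (padic_integers p) m)"
  shows "x \<otimes>\<^bsub>affine_space (padic_integers p) m\<^esub> inv\<^bsub>affine_space (padic_integers p) m\<^esub> y
      \<in> int_points (padic_integers p) m \<P> \<longleftrightarrow>
    (\<forall>P\<in>\<P>. \<forall>n. int p ^ Suc n dvd mpoly_val P (\<lambda>i. x i n - y i n))"
proof -
  have xy: "x i \<in> carrier (padic_integers p)" "y i \<in> carrier (padic_integers p)" if "i \<in> {1..m}" for i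
    using x y that by (auto simp: carrier_affine_space)
  have "eval_poly (padic_integers p) (\<lambda>c. add_pow (padic_integers p) c \<one>\<^bsub>padic_integers p\<^esub>) P
        (\<lambda>i\<in>{1..m}. x i \<ominus>\<^bsub>padic_integers p\<^esub> y i) = \<zero>\<^bsub>padic_integers p\<^esub> \<longleftrightarrow>
      (\<forall>n. int p ^ Suc n dvd mpoly_val P (\<lambda>i. x i n - y i n))" if P: "P \<in> \<P>" for P
  proof -
    have Pm: "P \<in> polys_in m" using P \<P> by blast
    have "eval_poly (padic_integers p) (\<lambda>c. add_pow (padic_integers p) c \<one>\<^bsub>padic_integers p\<^esub>) P
        (\<lambda>i\<in>{1..m}. x i \<ominus>\<^bsub>padic_integers p\<^esub> y i) n = mpoly_val P (\<lambda>i. x i n - y i n) mod int p ^ Suc n" for n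
    proof -
      have "eval_poly (padic_integers p) (\<lambda>c. add_pow (padic_integers p) c \<one>\<^bsub>padic_integers p\<^esub>) P
        (\<lambda>i\<in>{1..m}. x i \<ominus>\<^bsub>padic_integers p\<^esub> y i) n =
        mpoly_val P (\<lambda>i. (\<lambda>i\<in>{1..m}. x i \<ominus>\<^bsub>padic_integers p\<^esub> y i) i n) mod int p ^ Suc n"
        using xy by (intro eval_poly_padic[OF Pm]) auto
      also have "mpoly_val P (\<lambda>i. (\<lambda>i\<in>{1..m}. x i \<ominus>\<^bsub>padic_integers p\<^esub> y i) i n) =
        mpoly_val P (\<lambda>i. (x i n - y i n) mod int p ^ Suc n)"
        using xy by (intro mpoly_val_cong[OF Pm]) (simp add: padic_minus del: power_Suc)
      also have "int p ^ Suc n dvd mpoly_val P (\<lambda>i. (x i n - y i n) mod int p ^ Suc n) -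
          mpoly_val P (\<lambda>i. x i n - y i n)"
        using mpoly_val_congruent[OF subring_set_UNIV, of "{a. int p ^ Suc n dvd a}" P m
            "\<lambda>i. (x i n - y i n) mod int p ^ Suc n" "\<lambda>i. x i n - y i n", OF _ _ _ Pm]
        by (simp add: mod_eq_dvd_iff[symmetric] del: power_Suc)
      then have "mpoly_val P (\<lambda>i. (x i n - y i n) mod int p ^ Suc n) mod int p ^ Suc n =
          mpoly_val P (\<lambda>i. x i n - y i n) mod int p ^ Suc n"
        by (simp only: mod_eq_dvd_iff)
      finally show ?thesis .
    qed
    then show ?thesis by (simp add: fun_eq_iff padic_integers_simps(4) mod_eq_0_iff_dvd del: power_Suc)
  qed
  then show ?thesis
    by (simp add: diff_in_int_points_iff[OF cring_padic_integers[OF p] x y] cong: ball_cong)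
qed

end

lemma diff_in_int_points_complex_iff:
  assumes \<P>: "\<P> \<subseteq> polys_in m"
    and x: "x \<in> carrier (affine_space complex_ring m)"
    and y: "y \<in> carrier (affine_space complex_ring m)"
  shows "x \<otimes>\<^bsub>affine_space complex_ring m\<^esub> inv\<^bsub>affine_space complex_ring m\<^esub> y
      \<in> int_points complex_ring m \<P> \<longleftrightarrow> (\<forall>P\<in>\<P>. mpoly_val P (\<lambda>i. x i - y i) = 0)"
proof -
  have "mpoly_val P (\<lambda>i\<in>{1..m}. x i \<ominus>\<^bsub>complex_ring\<^esub> y i) = mpoly_val P (\<lambda>i. x i - y i)" if "P \<in> \<P>" for P
    using \<P> that
    by (intro mpoly_val_cong[of P m]) (auto simp: a_minus_def complex_ring_simps complex_ring_uminus)
  then show ?thesis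
    by (simp add: diff_in_int_points_iff[OF cring_from_type_algebra x y]
        eval_poly_complex_eq_mpoly_val complex_ring_simps(2))
qed

section \<open>The p-adic integers as a quotient of integer sequences\<close>

lemma of_int_fun: "(of_int c :: nat \<Rightarrow> int) n = c"
proof -
  have "ring_hom_on UNIV (\<lambda>x :: nat \<Rightarrow> int. x n)" by (simp add: ring_hom_on_def)
  from ring_hom_on_of_int[OF subring_set_UNIV this] show ?thesis by simp
qed

lemma mpoly_val_fun: "mpoly_val P x n = mpoly_val P (\<lambda>i. x i n)"
  for x :: "nat \<Rightarrow> nat \<Rightarrow> int"
proof -
  have pw: "(f ^ k) n = f n ^ k" for f :: "nat \<Rightarrow> int" and k by (induction k) simp_all
  have pr: "(\<Prod>i\<in>A. f i) n = (\<Prod>i\<in>A. f i n)" for f :: "nat \<Rightarrow> nat \<Rightarrow> int" and A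
    by (induction A rule: infinite_finite_induct) simp_all
  have sm: "(\<Sum>i\<in>A. f i) n = (\<Sum>i\<in>A. f i n)" for f :: "(nat \<Rightarrow>\<^sub>0 nat) \<Rightarrow> nat \<Rightarrow> int" and A
    by (induction A rule: infinite_finite_induct) simp_all
  show ?thesis by (simp add: mpoly_val_def sm pr pw of_int_fun)
qed

text \<open>Compatible sequences, unlike sequences of canonical residues, are closed under pointwise
  operations. Primality of the second set expresses that the p-adic integers have no zero
  divisors.\<close>

lemma prime_ideal_padic:
  assumes p: "prime (p :: nat)"
  shows "prime_ideal_on {x. \<forall>n. int p ^ Suc n dvd x (Suc n) - x n} {x :: nat \<Rightarrow> int. \<forall>n. int p ^ Suc n dvd x n}"
proof
  show "subring_set {x. \<forall>n. int p ^ Suc n dvd x (Suc n) - x n}"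
    unfolding subring_set_def
  proof (intro conjI ballI)
    fix x y :: "nat \<Rightarrow> int"
    assume x: "x \<in> {x. \<forall>n. int p ^ Suc n dvd x (Suc n) - x n}"
      and y: "y \<in> {x. \<forall>n. int p ^ Suc n dvd x (Suc n) - x n}"
    have "int p ^ Suc n dvd (x (Suc n) - x n) - (y (Suc n) - y n)" for n
      by (rule dvd_diff) (use x y in auto)
    then show "x - y \<in> {x. \<forall>n. int p ^ Suc n dvd x (Suc n) - x n}"
      by (simp add: algebra_simps del: power_Suc)
    have "int p ^ Suc n dvd x (Suc n) * (y (Suc n) - y n) + y n * (x (Suc n) - x n)" for n
      using x y by (intro dvd_add dvd_mult) auto
    then show "x * y \<in> {x. \<forall>n. int p ^ Suc n dvd x (Suc n) - x n}"
      by (simp add: algebra_simps del: power_Suc)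
  qed simp
  fix x y :: "nat \<Rightarrow> int"
  have step: "int p ^ Suc n dvd z (n + j) - z n" if "\<forall>n. int p ^ Suc n dvd z (Suc n) - z n" for z n j
  proof (induction j)
    case (Suc j)
    have "int p ^ Suc n dvd int p ^ Suc (n + j)" by (rule le_imp_power_dvd) simp
    then have "int p ^ Suc n dvd z (Suc (n + j)) - z (n + j)" using that dvd_trans by blast
    then have "int p ^ Suc n dvd (z (Suc (n + j)) - z (n + j)) + (z (n + j) - z n)"
      using Suc by (rule dvd_add)
    then show ?case by simp
  qed simp
  assume x: "x \<in> {x. \<forall>n. int p ^ Suc n dvd x (Suc n) - x n}"
    and y: "y \<in> {x. \<forall>n. int p ^ Suc n dvd x (Suc n) - x n}"
    and xy: "x * y \<in> {x. \<forall>n. int p ^ Suc n dvd x n}"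
  show "x \<in> {x. \<forall>n. int p ^ Suc n dvd x n} \<or> y \<in> {x. \<forall>n. int p ^ Suc n dvd x n}"
  proof (rule ccontr)
    assume "\<not> ?thesis"
    then obtain i j where ij: "\<not> int p ^ Suc i dvd x i" "\<not> int p ^ Suc j dvd y j" by blast
    \<comment> \<open>At this index the multiplicities of \<open>p\<close> in \<open>x N\<close> and
      \<open>y N\<close> are at most \<open>i\<close> and \<open>j\<close>, so
      \<open>p ^ (N + 1)\<close> does not divide the product.\<close>
    define N where "N = i + j"
    have "int p ^ Suc i dvd x N - x i" "int p ^ Suc j dvd y N - y j"
      using step[of x i j] step[of y j i] x y by (simp_all add: N_def add.commute del: power_Suc)
    then have nd: "\<not> int p ^ Suc i dvd x N" "\<not> int p ^ Suc j dvd y N"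
      using ij by (metis dvd_diff_commute dvd_diffD1 dvd_diff_right_iff)+
    then have nz: "x N \<noteq> 0" "y N \<noteq> 0" by auto
    have pp: "prime_elem (int p)" using p by simp
    have "multiplicity (int p) (x N) < Suc i" "multiplicity (int p) (y N) < Suc j"
      using nd nz p by (metis multiplicity_dvd' not_less)+
    then have "multiplicity (int p) (x N * y N) < Suc N"
      using prime_elem_multiplicity_mult_distrib[OF pp nz] by (simp add: N_def)
    moreover have "int p ^ Suc N dvd x N * y N" using xy by simp
    then have "Suc N \<le> multiplicity (int p) (x N * y N)"
      using nz p by (intro multiplicity_geI) (auto simp del: power_Suc)
    ultimately show False by simp
  qed
next
  have "\<not> int p ^ Suc 0 dvd 1" using p by auto
  then show "1 \<notin> {x :: nat \<Rightarrow> int. \<forall>n. int p ^ Suc n dvd x n}"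
    unfolding mem_Collect_eq one_fun_apply by blast
qed (auto simp del: power_Suc)

section \<open>Transfer of colourings between complex and p-adic graphs\<close>

lemma colourable_padic_if_complex:
  assumes p: "prime p" and \<P>: "\<P> \<subseteq> polys_in m"
    and col: "colourable (Cay (affine_space complex_ring m) (int_points complex_ring m \<P>)) k"
  shows "colourable (Cay (affine_space (padic_integers p) m) (int_points (padic_integers p) m \<P>)) k"
proof (rule colourable_Cay_if_finite)
  note Zp = cring_padic_integers[OF p]
  note C = cring_from_type_algebra[where 'a = complex]
  fix W assume W: "finite W" "W \<subseteq> carrier (affine_space (padic_integers p) m)"
  define T where "T = (\<Union>v\<in>W. v ` {1..m})"
  define U where "U = {x. \<forall>n. int p ^ Suc n dvd x (Suc n) - x n}"
  define I where "I = {x :: nat \<Rightarrow> int. \<forall>n. int p ^ Suc n dvd x n}"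
  interpret prime_ideal_on U I unfolding U_def I_def by (rule prime_ideal_padic[OF p])
  have T: "finite T" "T \<subseteq> carrier (padic_integers p)"
    using W by (auto simp: T_def carrier_affine_space)
  have TU: "T \<subseteq> U"
  proof
    fix x assume "x \<in> T"
    then have "x \<in> carrier (padic_integers p)" using T by blast
    then have "x (Suc n) mod int p ^ Suc n = x n mod int p ^ Suc n" for n
      by (simp add: padic_integers_simps(1) del: power_Suc)
    then show "x \<in> U" by (simp add: U_def mod_eq_dvd_iff del: power_Suc)
  qed
  \<comment> \<open>A nonzero \<open>c\<close> would be divisible by every power of
    \<open>p\<close>; the exponent \<open>Suc (nat \<bar>c\<bar>)\<close> is already too
    large.\<close>
  have char0: "c = 0" if "of_int c \<in> I" for c
  proof (rule ccontr)
    assume c: "c \<noteq> 0"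
    have "int p ^ Suc n dvd c" for n using that by (simp add: I_def of_int_fun del: power_Suc)
    then have "int p ^ Suc n \<le> \<bar>c\<bar>" for n using dvd_imp_le_int[OF c, of "int p ^ Suc n"] by (simp del: power_Suc)
    moreover have "int (Suc n) < int p ^ Suc n" for n
    proof -
      have "Suc n < p ^ Suc n" using power_gt_expt[of p "Suc n"] prime_gt_1_nat[OF p] by simp
      then have "int (Suc n) < int (p ^ Suc n)" by (simp only: of_nat_less_iff)
      then show ?thesis by (simp only: of_nat_power)
    qed
    ultimately have "int (Suc (nat \<bar>c\<bar>)) < \<bar>c\<bar>" using less_le_trans by blast
    then show False by simp
  qed
  \<comment> \<open>Points of \<open>T\<close> are sequences of canonical residues, so congruence of
    all entries means equality.\<close>
  have inj: "a = b" if ab: "a \<in> T" "b \<in> T" "a - b \<in> I" for a b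
  proof
    fix n
    have "int p ^ Suc n dvd a n - b n" using ab(3) by (simp add: I_def del: power_Suc)
    then have "a n mod int p ^ Suc n = b n mod int p ^ Suc n" by (simp only: mod_eq_dvd_iff)
    then show "a n = b n" using ab T padic_mod[OF p] by (metis subset_iff)
  qed
  obtain h :: "(nat \<Rightarrow> int) \<Rightarrow> complex" where h: "ring_hom_on (subring_set hull T) h"
    "\<And>x. x \<in> subring_set hull T \<Longrightarrow> x \<in> I \<Longrightarrow> h x = 0" "inj_on h T"
    using finitely_generated_inj_hom[OF T(1) TU char0 inj] by blast
  have hull: "subring_set (subring_set hull T)" "T \<subseteq> subring_set hull T"
    by (rule subring_set_hull, rule hull_subset)
  define f where "f v = (\<lambda>i\<in>{1..m}. h (v i))" for v
  have vT: "v i \<in> T" if "v \<in> W" "i \<in> {1..m}" for v i using that unfolding T_def by blast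
  have fc: "f v \<in> carrier (affine_space complex_ring m)" for v
    by (simp add: f_def carrier_affine_space complex_ring_simps)
  have inj_f: "inj_on f W"
  proof (rule inj_onI)
    fix v w assume vw: "v \<in> W" "w \<in> W" "f v = f w"
    have "v \<in> (\<Pi>\<^sub>E i\<in>{1..m}. carrier (padic_integers p))" "w \<in> (\<Pi>\<^sub>E i\<in>{1..m}. carrier (padic_integers p))"
      using vw W by (auto simp: carrier_affine_space)
    then show "v = w"
    proof (rule PiE_ext)
      fix i assume i: "i \<in> {1..m}"
      have "h (v i) = h (w i)" using fun_cong[OF vw(3), of i] i by (simp add: f_def)
      then show "v i = w i" using inj_onD[OF h(3)] vT vw i by blast
    qed
  qed
  have edges: "f v \<otimes>\<^bsub>affine_space complex_ring m\<^esub> inv\<^bsub>affine_space complex_ring m\<^esub> f w \<in> int_points complex_ring m \<P>"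
    if vw: "v \<in> W" "w \<in> W" "v \<otimes>\<^bsub>affine_space (padic_integers p) m\<^esub> inv\<^bsub>affine_space (padic_integers p) m\<^esub> w
      \<in> int_points (padic_integers p) m \<P>" for v w
  proof -
    have vwc: "v \<in> carrier (affine_space (padic_integers p) m)" "w \<in> carrier (affine_space (padic_integers p) m)"
      using vw W by auto
    have "mpoly_val P (\<lambda>i. f v i - f w i) = 0" if P: "P \<in> \<P>" for P
    proof -
      have Pm: "P \<in> polys_in m" using P \<P> by blast
      have mem: "v i - w i \<in> subring_set hull T" if "i \<in> {1..m}" for i
        using vT[OF _ that] vw hull by (intro subring_set_diff[OF hull(1)]) auto
      have "mpoly_val P (\<lambda>i. v i - w i) \<in> I"
        using vw(3) P unfolding diff_in_int_points_padic_iff[OF p \<P> vwc] I_def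
        by (simp add: mpoly_val_fun del: power_Suc)
      then have "h (mpoly_val P (\<lambda>i. v i - w i)) = 0"
        using mem by (intro h(2) mpoly_val_closed[OF hull(1) Pm])
      also have "h (mpoly_val P (\<lambda>i. v i - w i)) = mpoly_val P (\<lambda>i. h (v i - w i))"
        using mem by (rule mpoly_val_hom[OF hull(1) h(1) Pm])
      also have "\<dots> = mpoly_val P (\<lambda>i. f v i - f w i)"
      proof (rule mpoly_val_cong[OF Pm])
        fix i assume i: "i \<in> {1..m}"
        then have "v i \<in> subring_set hull T" "w i \<in> subring_set hull T" using vT vw hull by auto
        then show "h (v i - w i) = f v i - f w i"
          using i by (simp add: f_def ring_hom_on_diff[OF hull(1) h(1)])
      qed
      finally show ?thesis .
    qed
    then show ?thesis by (simp add: diff_in_int_points_complex_iff[OF \<P> fc fc])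
  qed
  show "colourable (W, snd (Cay (affine_space (padic_integers p) m)
      (int_points (padic_integers p) m \<P>))) k"
    by (rule colourable_Cay_embedding[OF group_affine_space[OF Zp] int_points_subset
          group_affine_space[OF C] int_points_subset fc inj_f edges col])
qed

text \<open>The assignment \<open>y\<close> is not given as a ring homomorphism. Each equation is
  therefore first moved through \<open>h\<close> to \<open>qbar\<close>, and \<open>y\<close> is
  then applied to single coordinates only.\<close>

lemma colourable_complex_if_padic:
  assumes \<P>: "\<P> \<subseteq> polys_in m"
    and col: "\<And>p. prime p \<Longrightarrow> colourable (Cay (affine_space (padic_integers p) m) (int_points (padic_integers p) m \<P>)) k"
  shows "colourable (Cay (affine_space complex_ring m) (int_points complex_ring m \<P>)) k"
proof (rule colourable_Cay_if_finite)
  note C = cring_from_type_algebra[where 'a = complex]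
  fix W assume W: "finite W" "W \<subseteq> carrier (affine_space complex_ring m)"
  define T where "T = (\<Union>v\<in>W. v ` {1..m})"
  interpret prime_ideal_on UNIV "{0 :: complex}"
    by unfold_locales (auto simp: subring_set_UNIV)
  have T: "finite T" using W by (auto simp: T_def)
  obtain h :: "complex \<Rightarrow> qbar" where h: "ring_hom_on (subring_set hull T) h" "inj_on h T"
    by (rule finitely_generated_inj_hom[OF T subset_UNIV, where 'k = qbar]) (simp, simp, rule that)
  have hull: "subring_set (subring_set hull T)" "T \<subseteq> subring_set hull T"
    by (rule subring_set_hull, rule hull_subset)
  show "colourable (W, snd (Cay (affine_space complex_ring m) (int_points complex_ring m \<P>))) k"
  proof (rule algebraic_numbers_to_padic[OF finite_imageI[OF T, of h]])
    fix p and y :: "qbar \<Rightarrow> nat \<Rightarrow> int"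
    assume p: "prime p" and y: "\<And>t. t \<in> h ` T \<Longrightarrow> y t \<in> carrier (padic_integers p)" "inj_on y (h ` T)"
      "\<And>P m x x' n. P \<in> polys_in m \<Longrightarrow> (\<And>i. i \<in> {1..m} \<Longrightarrow> x i \<in> h ` T \<and> x' i \<in> h ` T) \<Longrightarrow>
         mpoly_val P (\<lambda>i. x i - x' i) = 0 \<Longrightarrow>
         int p ^ Suc n dvd mpoly_val P (\<lambda>i. y (x i) n - y (x' i) n)"
    define f where "f v = (\<lambda>i\<in>{1..m}. y (h (v i)))" for v
    have vT: "v i \<in> T" if "v \<in> W" "i \<in> {1..m}" for v i using that unfolding T_def by blast
    have fc: "f v \<in> carrier (affine_space (padic_integers p) m)" if "v \<in> W" for v
      using y(1) vT[OF that] by (auto simp: f_def carrier_affine_space)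
    have inj_f: "inj_on f W"
    proof (rule inj_onI)
      fix v w assume vw: "v \<in> W" "w \<in> W" "f v = f w"
      have "v \<in> (\<Pi>\<^sub>E i\<in>{1..m}. UNIV)" "w \<in> (\<Pi>\<^sub>E i\<in>{1..m}. UNIV)"
        using vw W by (auto simp: carrier_affine_space complex_ring_simps)
      then show "v = w"
      proof (rule PiE_ext)
        fix i assume i: "i \<in> {1..m}"
        have "y (h (v i)) = y (h (w i))" using fun_cong[OF vw(3), of i] i by (simp add: f_def)
        then have "h (v i) = h (w i)" using inj_onD[OF y(2)] vT vw i by blast
        then show "v i = w i" using inj_onD[OF h(2)] vT vw i by blast
      qed
    qed
    have edges: "f v \<otimes>\<^bsub>affine_space (padic_integers p) m\<^esub> inv\<^bsub>affine_space (padic_integers p) m\<^esub> f w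
        \<in> int_points (padic_integers p) m \<P>"
      if vw: "v \<in> W" "w \<in> W" "v \<otimes>\<^bsub>affine_space complex_ring m\<^esub> inv\<^bsub>affine_space complex_ring m\<^esub> w
        \<in> int_points complex_ring m \<P>" for v w
    proof -
      have vwc: "v \<in> carrier (affine_space complex_ring m)" "w \<in> carrier (affine_space complex_ring m)"
        using vw W by auto
      have "int p ^ Suc n dvd mpoly_val P (\<lambda>i. f v i n - f w i n)" if P: "P \<in> \<P>" for P n
      proof -
        have Pm: "P \<in> polys_in m" using P \<P> by blast
        have mem: "v i \<in> subring_set hull T" "w i \<in> subring_set hull T" "v i - w i \<in> subring_set hull T"
          if "i \<in> {1..m}" for i
          using vT[OF _ that] vw hull by (auto intro: subring_set_diff[OF hull(1)])
        have "mpoly_val P (\<lambda>i. h (v i) - h (w i)) = mpoly_val P (\<lambda>i. h (v i - w i))"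
          using mem by (intro mpoly_val_cong[OF Pm]) (simp add: ring_hom_on_diff[OF hull(1) h(1)])
        also have "\<dots> = h (mpoly_val P (\<lambda>i. v i - w i))"
          using mem(3) by (rule mpoly_val_hom[OF hull(1) h(1) Pm, symmetric])
        also have "mpoly_val P (\<lambda>i. v i - w i) = 0"
          using vw(3) P unfolding diff_in_int_points_complex_iff[OF \<P> vwc] by blast
        finally have "mpoly_val P (\<lambda>i. h (v i) - h (w i)) = 0"
          by (simp add: ring_hom_on_0[OF hull(1) h(1)])
        then have "int p ^ Suc n dvd mpoly_val P (\<lambda>i. y (h (v i)) n - y (h (w i)) n)"
          using vT vw by (intro y(3)[OF Pm]) auto
        also have "mpoly_val P (\<lambda>i. y (h (v i)) n - y (h (w i)) n) = mpoly_val P (\<lambda>i. f v i n - f w i n)"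
          by (rule mpoly_val_cong[OF Pm]) (simp add: f_def)
        finally show ?thesis .
      qed
      then show ?thesis using vw by (simp add: diff_in_int_points_padic_iff[OF p \<P> fc fc] del: power_Suc)
    qed
    show "colourable (W, snd (Cay (affine_space complex_ring m) (int_points complex_ring m \<P>))) k"
      by (rule colourable_Cay_embedding[OF group_affine_space[OF C] int_points_subset
            group_affine_space[OF cring_padic_integers[OF p]] int_points_subset fc inj_f edges col[OF p]])
  qed
qed

theorem theorem1p13:
  fixes m n :: nat and F :: "nat \<Rightarrow> int mpol"
  assumes "\<And>i. i \<in> {1..n} \<Longrightarrow> F i \<in> polys_in m"
    and "irreducible_over_rat m (int_points complex_ring m (F ` {1..n}))"
    and "finite_card (chromatic_number
                    (Cay (affine_space complex_ring m) (int_points complex_ring m (F ` {1..n}))))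
       \<or> finite_card (card_sup ((\<lambda>p. chromatic_number
                    (Cay (affine_space (padic_integers p) m)
                         (int_points (padic_integers p) m (F ` {1..n})))) ` {p. prime p}))"
  shows "chromatic_number
           (Cay (affine_space complex_ring m) (int_points complex_ring m (F ` {1..n})))
         =o card_sup ((\<lambda>p. chromatic_number
              (Cay (affine_space (padic_integers p) m)
                   (int_points (padic_integers p) m (F ` {1..n})))) ` {p. prime p})"
proof (rule ordIso_if_same_finite_bounds[OF chromatic_number_Card_order card_sup_Card_order _ assms(3)])
  fix k :: nat
  define K where "K = (\<lambda>p. chromatic_number (Cay (affine_space (padic_integers p) m)
      (int_points (padic_integers p) m (F ` {1..n})))) ` {p. prime p}"
  have \<P>: "F ` {1..n} \<subseteq> polys_in m" using assms(1) by blast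
  have K: "\<forall>r\<in>K. Card_order r" by (auto simp: K_def chromatic_number_Card_order)
  \<comment> \<open>A supremum lies below \<open>k\<close> exactly when all members do;
    \<open>card_sup_least\<close> permits this although \<open>{..<k}\<close> lives over another
    type.\<close>
  have "card_sup K \<le>o |{..<k}| \<longleftrightarrow> (\<forall>r\<in>K. r \<le>o |{..<k}| )"
    using card_sup_upper[OF K] card_sup_least[OF K card_of_Card_order] ordLeq_transitive by blast
  also have "\<dots> \<longleftrightarrow> (\<forall>p. prime p \<longrightarrow> colourable (Cay (affine_space (padic_integers p) m)
      (int_points (padic_integers p) m (F ` {1..n}))) k)"
    by (auto simp: K_def chromatic_number_le_iff_colourable irrefl_Cay)
  also have "\<dots> \<longleftrightarrow> colourable (Cay (affine_space complex_ring m) (int_points complex_ring m (F ` {1..n}))) k"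
    using colourable_padic_if_complex[OF _ \<P>] colourable_complex_if_padic[OF \<P>] by blast
  finally show "chromatic_number (Cay (affine_space complex_ring m) (int_points complex_ring m (F ` {1..n})))
      \<le>o |{..<k}| \<longleftrightarrow> card_sup K \<le>o |{..<k}|"
    by (simp add: chromatic_number_le_iff_colourable irrefl_Cay)
qed

end
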